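(* Consider the family $\mathcal{G}=(\mathbb{Z}_{n+2},Q_n,U_n)_{n=1}^\infty$, where $Q_n(0)=1/2$, $Q_n(1)=Q_n(-1)=1/4$ and $U_n$ is the uniform probability on $\mathbb{Z}_{n+2}$. Let $(X_n)_{n=1}^\infty$ be i.i.d. positive random variables and let $\mathcal{P}=(p_n)_{n=1}^\infty$ be a random sequence given by $(X_n)_{n=1}^\infty$ as follows. (1) Suppose $p_n=(X_1+\cdots+X_n)^\gamma$ with $\gamma>0$ and $X_1$ has a finite expectation. If $\gamma\in(0,2]$, then $\mathcal{G}^{\mathcal{P}}$ has a total variation cutoff with probability $1$. If $\gamma>2$, then $\mathcal{G}^{\mathcal{P}}$ has no total variation cutoff with probability $1$. (2) Suppose $p_n=X_1\times\cdots\times X_n$ and $\log X_1$ has a positive finite expectation. Then $\mathcal{G}^{\mathcal{P}}$ has no total variation cutoff with probability $1$.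
   Context: A (discrete time) random walk $(G,Q,U)$ on a finite group $G$ driven by a probability $Q$ is the Markov chain on $G$ with transition matrix $K(x,y)=Q(x^{-1}y)$; $U$ is the uniform distribution on $G$. Its total variation is $d_{\mathrm{TV}}(m)=\max_{E\subset G}\{Q^{(m)}(E)-U(E)\}$, where $Q^{(m)}$ is the $m$-fold convolution $Q*\cdots*Q$, $f*g(x)=\sum_{z\in G}f(z)g(z^{-1}x)$ (the distance does not depend on the starting point). Its mixing time is $T_{\mathrm{TV}}(\epsilon)=\min\{m\ge 0: d_{\mathrm{TV}}(m)\le\epsilon\}$. Products: given random walks $(G_i,Q_i,U_i)_{i=1}^n$ and a probability vector $(r_1,\dots,r_n)$, their product with respect to $(r_1,\dots,r_n)$ is the random walk on $G_1\times\cdots\times G_n$ which at each step chooses coordinate $i$ with probability $r_i$ and moves that coordinate according to $Q_i$, leaving the others fixed. (That is, it is driven by $Q=\sum_{i=1}^n r_i\check Q_i$, where $\check Q_i$ is the image of $Q_i$ under the embedding of $G_i$ as the $i$th factor.) Given $\mathcal{G}=(G_n,Q_n,U_n)_{n=1}^\infty$ and positive reals $\mathcal{P}=(p_n)_{n=1}^\infty$, put $q_n=\sum_{i=1}^n p_i$; $\mathcal{G}^{\mathcal{P}}$ is the family whose $n$th random walk is the product of $(G_i,Q_i,U_i)_{i=1}^n$ with respect to $(p_1/q_n,\dots,p_n/q_n)$. When $\mathcal{P}$ is random, $\mathcal{G}^{\mathcal{P}}$ is defined realization by realization, and "with probability 1" refers to the randomness of $(X_n)$. Cutoff: let a family of discrete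 time random walks have total variations $d_{n,\mathrm{TV}}$ and mixing times $T_{n,\mathrm{TV}}$, with $T_{n,\mathrm{TV}}(\epsilon_0)\to\infty$ for some $\epsilon_0\in(0,1)$. It has a total variation cutoff if $\lim_{n\to\infty}T_{n,\mathrm{TV}}(\epsilon)/T_{n,\mathrm{TV}}(\delta)=1$ for all $\epsilon,\delta\in(0,1)$; equivalently, there are $t_n>0$ with $d_{n,\mathrm{TV}}(\lceil at_n\rceil)\to0$ for all $a>1$ and $d_{n,\mathrm{TV}}(\lfloor at_n\rfloor)\to1$ for all $a\in(0,1)$. *)

theory Defs
  imports "HOL-Probability.Probability" "HOL-Algebra.Product_Groups"
    "HOL-Algebra.Elementary_Groups"
begin

text \<open>
  A random walk on a finite group is given by the group \<open>G\<close> and the probability mass function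
  \<open>Q\<close> driving it; only the values of \<open>Q\<close> on \<open>carrier G\<close> matter.
\<close>

definition convolution ::
  "('a, 'b) monoid_scheme \<Rightarrow> ('a \<Rightarrow> real) \<Rightarrow> ('a \<Rightarrow> real) \<Rightarrow> 'a \<Rightarrow> real"
  where "convolution G f g x = (\<Sum>z\<in>carrier G. f z * g (inv\<^bsub>G\<^esub> z \<otimes>\<^bsub>G\<^esub> x))"

text \<open>The zeroth power is the point mass at the identity, i.e. the walk at time 0.\<close>

primrec conv_power :: "('a, 'b) monoid_scheme \<Rightarrow> ('a \<Rightarrow> real) \<Rightarrow> nat \<Rightarrow> 'a \<Rightarrow> real"
  where
    "conv_power G Q 0 = (\<lambda>x. if x = \<one>\<^bsub>G\<^esub> then 1 else 0)"
  | "conv_power G Q (Suc m) = convolution G (conv_power G Q m) Q"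

definition d_TV :: "('a, 'b) monoid_scheme \<Rightarrow> ('a \<Rightarrow> real) \<Rightarrow> nat \<Rightarrow> real"
  where "d_TV G Q m =
    (MAX E\<in>Pow (carrier G).
       (\<Sum>x\<in>E. conv_power G Q m x) - real (card E) / real (card (carrier G)))"

text \<open>
  As with every use of \<open>LEAST\<close>, this is meaningful if some \<open>m\<close> qualifies; so it is for
  all ergodic walks and \<open>\<epsilon> > 0\<close>.
\<close>

definition T_TV :: "('a, 'b) monoid_scheme \<Rightarrow> ('a \<Rightarrow> real) \<Rightarrow> real \<Rightarrow> nat"
  where "T_TV G Q \<epsilon> = (LEAST m. d_TV G Q m \<le> \<epsilon>)"

definition factor_embed ::
  "'i set \<Rightarrow> ('i \<Rightarrow> ('a, 'b) monoid_scheme) \<Rightarrow> 'i \<Rightarrow> 'a \<Rightarrow> 'i \<Rightarrow> 'a"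
  where "factor_embed I G i y = (\<lambda>j\<in>I. if j = i then y else \<one>\<^bsub>G j\<^esub>)"

definition lifted_prob ::
  "'i set \<Rightarrow> ('i \<Rightarrow> ('a, 'b) monoid_scheme) \<Rightarrow> ('i \<Rightarrow> 'a \<Rightarrow> real) \<Rightarrow> 'i \<Rightarrow> ('i \<Rightarrow> 'a) \<Rightarrow> real"
  where "lifted_prob I G Q i x = (\<Sum>y | y \<in> carrier (G i) \<and> factor_embed I G i y = x. Q i y)"

text \<open>
  Driving probability, on \<open>product_group I G\<close>, of the product with respect to the
  probability vector \<open>r\<close>.
\<close>

definition product_prob ::
  "'i set \<Rightarrow> ('i \<Rightarrow> ('a, 'b) monoid_scheme) \<Rightarrow> ('i \<Rightarrow> 'a \<Rightarrow> real) \<Rightarrow> ('i \<Rightarrow> real)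
    \<Rightarrow> ('i \<Rightarrow> 'a) \<Rightarrow> real"
  where "product_prob I G Q r x = (\<Sum>i\<in>I. r i * lifted_prob I G Q i x)"

text \<open>
  The \<open>n\<close>th random walk of \<open>\<G>\<^sup>\<P>\<close>; families are indexed by \<open>n \<ge> 1\<close>
  and their members at \<open>0\<close> are irrelevant.
\<close>

definition family_group ::
  "(nat \<Rightarrow> ('a, 'b) monoid_scheme) \<Rightarrow> nat \<Rightarrow> (nat \<Rightarrow> 'a) monoid"
  where "family_group G n = product_group {1..n} G"

definition family_prob ::
  "(nat \<Rightarrow> ('a, 'b) monoid_scheme) \<Rightarrow> (nat \<Rightarrow> 'a \<Rightarrow> real) \<Rightarrow> (nat \<Rightarrow> real)
    \<Rightarrow> nat \<Rightarrow> (nat \<Rightarrow> 'a) \<Rightarrow> real"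
  where "family_prob G Q p n = product_prob {1..n} G Q (\<lambda>i. p i / (\<Sum>j=1..n. p j))"

text \<open>
  Standing assumption under which cutoff is considered; without it, quotients of mixing times need
  not be meaningful.
\<close>

definition TV_mixing_diverges ::
  "(nat \<Rightarrow> ('a, 'b) monoid_scheme) \<Rightarrow> (nat \<Rightarrow> 'a \<Rightarrow> real) \<Rightarrow> bool"
  where "TV_mixing_diverges G Q \<longleftrightarrow>
    (\<exists>\<epsilon>0\<in>{0<..<1}. filterlim (\<lambda>n. T_TV (G n) (Q n) \<epsilon>0) at_top sequentially)"

definition TV_cutoff ::
  "(nat \<Rightarrow> ('a, 'b) monoid_scheme) \<Rightarrow> (nat \<Rightarrow> 'a \<Rightarrow> real) \<Rightarrow> bool"
  where "TV_cutoff G Q \<longleftrightarrow>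
    (\<forall>\<epsilon>\<in>{0<..<1}. \<forall>\<delta>\<in>{0<..<1}.
       (\<lambda>n. real (T_TV (G n) (Q n) \<epsilon>) / real (T_TV (G n) (Q n) \<delta>)) \<longlonglongrightarrow> 1)"

definition zmod_group :: "nat \<Rightarrow> int monoid"
  where "zmod_group n = integer_mod_group (n + 2)"

definition zmod_prob :: "nat \<Rightarrow> int \<Rightarrow> real"
  where "zmod_prob n x =
    (if x = 0 then 1/2 else if x = 1 \<or> x = inv\<^bsub>zmod_group n\<^esub> 1 then 1/4 else 0)"

definition iid_positive :: "'w measure \<Rightarrow> (nat \<Rightarrow> 'w \<Rightarrow> real) \<Rightarrow> bool"
  where "iid_positive M X \<longleftrightarrow>
    prob_space.indep_vars M (\<lambda>_. borel) X {1..} \<and>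
    (\<forall>n\<ge>1. distr M borel (X n) = distr M borel (X 1)) \<and>
    (\<forall>n\<ge>1. AE \<omega> in M. X n \<omega> > 0)"

end

theory Submission
  imports Defs "HOL-Real_Asymp.Real_Asymp"
begin

text \<open>
  Write \<open>N i = i + 2\<close>, \<open>r i = p i / (p 1 + \<dots> + p n)\<close> and
  \<open>gap i = sin\<^sup>2 (\<pi> / N i)\<close>, the spectral gap of the lazy walk on the \<open>i\<close>th cycle. Products
  of cosines, one factor for each coordinate, are eigenfunctions of the product walk, with eigenvalue
  \<open>1 - (\<Sum>i. r i * sin\<^sup>2 (\<pi> * k i / N i))\<close> at frequency \<open>k\<close>. Coordinate \<open>i\<close> hence relaxes at
  rate \<open>r i * gap i\<close>, which is \<open>p i * gap i\<close> up to the time scale \<open>q n = p 1 + \<dots> + p n\<close> common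
  to all coordinates, and \<open>p i * gap i\<close> is of order \<open>p i / i\<^sup>2\<close>. Whether there is a cutoff depends
  on how many coordinates are nearly slowest.

  All that is needed about the walk is three inequalities. By the Plancherel identity and
  \<open>1 - x \<le> exp (- x)\<close>, the squared distance at time \<open>m \<ge> 1\<close> is at most
  \<open>(exp (\<Sum>i. 2 / (exp (2 * m * r i * gap i) - 1)) - 1) / 4\<close> (\<open>d_TV_upper\<close>); the laziness makes
  all eigenvalues nonnegative, so that this holds in discrete time without any parity problem. One
  cosine as a test function bounds the distance below by \<open>(1 - r i * gap i) ^ m / 2\<close>
  (\<open>d_TV_lower_one_coordinate\<close>). The sum of the cosines over a set \<open>J\<close> of coordinates has negatively
  correlated terms, and Chebyshev's inequality shows that the distance is still close to 1 as long as
  \<open>card J * (1 - \<rho>) ^ (2 * m)\<close> is large, where \<open>\<rho>\<close> is the largest rate in \<open>J\<close>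
  (\<open>d_TV_lower_many_coordinates\<close>).

  If \<open>p i\<close> is asymptotic to \<open>c * i powr \<gamma>\<close> with \<open>0 < \<gamma> \<le> 2\<close>, the rates \<open>p i * gap i\<close> behave like
  \<open>c * \<pi>\<^sup>2 * i powr (\<gamma> - 2)\<close>, which does not increase, so a positive fraction of all coordinates has
  nearly the smallest rate. The upper and the second lower bound then meet at the time
  \<open>q n * n powr (2 - \<gamma>) * ln n / (2 * c * \<pi>\<^sup>2)\<close>: there is a cutoff (\<open>cutoff_if_power_law\<close>). If
  \<open>p i * gap i\<close> grows faster than \<open>ln i\<close>, the sum in the upper bound converges uniformly in \<open>n\<close>, so
  the mixing time has order \<open>q n\<close>, while by the first coordinate alone \<open>T (\<epsilon>) / q n\<close> is unbounded
  as \<open>\<epsilon>\<close> tends to 0: there is no cutoff (\<open>no_cutoff_if_rates_outgrow_log\<close>).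

  The random weights fall under these two cases by the strong law of large numbers, applied to
  \<open>X i\<close> and to \<open>ln (X i)\<close>. The strong law in turn follows from the maximal ergodic inequality and
  Kolmogorov's zero-one law (\<open>partial_sums_bounded_below\<close>).
\<close>

section \<open>The strong law of large numbers\<close>

lemma (in prob_space) indep_vars_reindex:
  assumes inj: "inj_on f I" and indep: "indep_vars (\<lambda>_. N) X (f ` I)"
  shows "indep_vars (\<lambda>_. N) (\<lambda>i. X (f i)) I"
proof -
  let ?F = "\<lambda>i. {X i -` A \<inter> space M |A. A \<in> sets N}"
  have rv: "random_variable N (X (f i))" if "i \<in> I" for i
    using indep that unfolding indep_vars_def2 by auto
  have sets: "indep_sets ?F (f ` I)"
    using indep unfolding indep_vars_def2 by auto
  have "indep_sets (\<lambda>i. ?F (f i)) I"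
  proof (rule indep_setsI)
    show "?F (f i) \<subseteq> events" if "i \<in> I" for i
      using sets that unfolding indep_sets_def by blast
  next
    fix A J assume J: "J \<noteq> {}" "J \<subseteq> I" "finite J" "\<forall>j\<in>J. A j \<in> ?F (f j)"
    have injJ: "inj_on f J" using inj J(2) inj_on_subset by blast
    define g where "g = the_inv_into J f"
    have g: "g (f j) = j" if "j \<in> J" for j
      unfolding g_def using that injJ by (simp add: the_inv_into_f_f)
    have "prob (\<Inter>k\<in>f ` J. A (g k)) = (\<Prod>k\<in>f ` J. prob (A (g k)))"
      by (rule indep_setsD[OF sets]) (use J g in auto)
    then show "prob (\<Inter>j\<in>J. A j) = (\<Prod>j\<in>J. prob (A j))"
      using g by (simp add: prod.reindex[OF injJ])
  qed
  then show ?thesis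
    unfolding indep_vars_def2 using rv by auto
qed

text \<open>
  The minimum of the partial sums \<open>0, y 0, y 0 + y 1, \<dots>\<close> of length at most \<open>n\<close>, in the recursive
  form that splits off \<open>y 0\<close> and shifts the sequence, which is how stationarity enters below.
\<close>
primrec min_partial_sum :: "nat \<Rightarrow> (nat \<Rightarrow> real) \<Rightarrow> real" where
  "min_partial_sum 0 y = 0"
| "min_partial_sum (Suc n) y = min 0 (y 0 + min_partial_sum n (\<lambda>i. y (Suc i)))"

lemma min_partial_sum_le_0: "min_partial_sum n y \<le> 0"
  by (cases n) auto

lemma min_partial_sum_le: "k \<le> n \<Longrightarrow> min_partial_sum n y \<le> (\<Sum>i<k. y i)"
proof (induction n arbitrary: k y)
  case (Suc n)
  show ?case
  proof (cases k)
    case 0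
    then show ?thesis by simp
  next
    case (Suc k')
    have "min_partial_sum n (\<lambda>i. y (Suc i)) \<le> (\<Sum>i<k'. y (Suc i))"
      using Suc.IH Suc.prems \<open>k = Suc k'\<close> by simp
    then show ?thesis
      using \<open>k = Suc k'\<close> by (simp add: sum.lessThan_Suc_shift del: sum.lessThan_Suc)
  qed
qed simp

lemma min_partial_sum_Suc_le: "min_partial_sum (Suc n) y \<le> min_partial_sum n y"
proof (induction n arbitrary: y)
  case (Suc n)
  show ?case
    using Suc.IH[of "\<lambda>i. y (Suc i)"] by (simp add: min_def split: if_splits)
qed simp

lemma abs_min_partial_sum_le: "\<bar>min_partial_sum n y\<bar> \<le> (\<Sum>i<n. \<bar>y i\<bar>)"
proof (induction n arbitrary: y)
  case (Suc n)
  show ?case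
    using Suc.IH[of "\<lambda>i. y (Suc i)"]
    by (simp add: sum.lessThan_Suc_shift del: sum.lessThan_Suc)
qed simp

lemma borel_measurable_min_partial_sum[measurable]:
  "min_partial_sum n \<in> borel_measurable (Pi\<^sub>M UNIV (\<lambda>_. borel))"
proof (induction n)
  case (Suc n)
  have "(\<lambda>y i. y (Suc i)) \<in> Pi\<^sub>M UNIV (\<lambda>_. borel) \<rightarrow>\<^sub>M Pi\<^sub>M (UNIV::nat set) (\<lambda>_. borel :: real measure)"
    by (rule measurable_PiM_single') auto
  from measurable_compose[OF this Suc] show ?case
    unfolding min_partial_sum.simps
    by (intro borel_measurable_min borel_measurable_const borel_measurable_add
        measurable_component_singleton UNIV_I)
qed simp

text \<open>
  On the event that the minimal partial sum \<open>L (n + 1)\<close> is negative it equals \<open>Y 0\<close> plus the minimal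
  partial sum \<open>L' n\<close> of the shifted sequence; off this event \<open>0 \<le> L (n + 1) - L' n\<close>. Since
  \<open>L' n\<close> is distributed like \<open>L n\<close>, which is at least \<open>L (n + 1)\<close>, the mean of \<open>Y 0\<close> over this
  event is at most 0. If almost surely some partial sum were negative, letting \<open>n\<close> tend to infinity
  would make the mean of \<open>Y 0\<close> at most 0. Hence with positive probability the partial sums are
  bounded below, and as this is a tail event, it has probability 1.
\<close>
lemma (in prob_space) partial_sums_bounded_below:
  fixes Y :: "nat \<Rightarrow> 'a \<Rightarrow> real"
  assumes indep: "indep_vars (\<lambda>_. borel) Y UNIV"
    and ident: "\<And>i. distr M borel (Y i) = distr M borel (Y 0)"
    and int: "integrable M (Y 0)" and pos: "expectation (Y 0) > 0"
  shows "AE \<omega> in M. \<exists>C. \<forall>n. C \<le> (\<Sum>i<n. Y i \<omega>)"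
proof -
  have rv [measurable]: "random_variable borel (Y i)" for i
    using indep unfolding indep_vars_def2 by auto
  have int_i: "integrable M (Y i)" for i
  proof -
    have "integrable (distr M borel (Y i)) (\<lambda>x. x)"
      by (subst ident) (simp add: integrable_distr_eq int)
    then show ?thesis by (simp add: integrable_distr_eq)
  qed
  let ?P = "Pi\<^sub>M (UNIV::nat set) (\<lambda>_. borel :: real measure)"
  define Z0 where "Z0 = (\<lambda>\<omega> i. Y i \<omega>)"
  define Z1 where "Z1 = (\<lambda>\<omega> i. Y (Suc i) \<omega>)"
  have Z0 [measurable]: "Z0 \<in> M \<rightarrow>\<^sub>M ?P" and Z1 [measurable]: "Z1 \<in> M \<rightarrow>\<^sub>M ?P"
    unfolding Z0_def Z1_def by (rule measurable_PiM_single'; auto)+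
  have "indep_vars (\<lambda>_. borel) Y (range Suc)"
    using indep_vars_subset[OF indep] by blast
  from indep_vars_reindex[OF _ this]
  have "indep_vars (\<lambda>_. borel) (\<lambda>i. Y (Suc i)) UNIV" by simp
  then have "distr M ?P Z1 = (\<Pi>\<^sub>M i\<in>UNIV. distr M borel (Y (Suc i)))"
    unfolding Z1_def by (subst (asm) indep_vars_iff_distr_eq_PiM) (auto simp: restrict_UNIV)
  also have "\<dots> = (\<Pi>\<^sub>M i\<in>UNIV. distr M borel (Y i))"
    by (intro PiM_cong refl) (metis ident)
  also have "\<dots> = distr M ?P Z0"
    using indep unfolding Z0_def by (subst (asm) indep_vars_iff_distr_eq_PiM) (auto simp: restrict_UNIV)
  finally have same: "distr M ?P Z1 = distr M ?P Z0" .
  have int0: "integrable M (\<lambda>\<omega>. min_partial_sum n (Z0 \<omega>))" for n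
  proof (rule Bochner_Integration.integrable_bound)
    show "integrable M (\<lambda>\<omega>. \<Sum>i<n. \<bar>Y i \<omega>\<bar>)" using int_i by auto
    show "AE \<omega> in M. norm (min_partial_sum n (Z0 \<omega>)) \<le> norm (\<Sum>i<n. \<bar>Y i \<omega>\<bar>)"
      using abs_min_partial_sum_le[of n] by (intro AE_I2) (force simp: Z0_def)
  qed measurable
  have int1: "integrable M (\<lambda>\<omega>. min_partial_sum n (Z1 \<omega>))" for n
  proof -
    have "integrable (distr M ?P Z0) (min_partial_sum n)"
      using int0 by (simp add: integrable_distr_eq)
    then show ?thesis
      unfolding same[symmetric] by (simp add: integrable_distr_eq)
  qed
  have exp1: "expectation (\<lambda>\<omega>. min_partial_sum n (Z1 \<omega>)) = expectation (\<lambda>\<omega>. min_partial_sum n (Z0 \<omega>))" for n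
  proof -
    have "integral\<^sup>L (distr M ?P Z1) (min_partial_sum n) = integral\<^sup>L (distr M ?P Z0) (min_partial_sum n)"
      by (simp add: same)
    then show ?thesis by (simp add: integral_distr)
  qed
  define N where "N n = {\<omega> \<in> space M. min_partial_sum (Suc n) (Z0 \<omega>) < 0}" for n
  have N [measurable]: "N n \<in> events" for n unfolding N_def by measurable
  \<comment> \<open>This is Hopf's maximal inequality.\<close>
  have hopf: "expectation (\<lambda>\<omega>. indicator (N n) \<omega> * Y 0 \<omega>) \<le> 0" for n
  proof -
    have "expectation (\<lambda>\<omega>. indicator (N n) \<omega> * Y 0 \<omega>)
      \<le> expectation (\<lambda>\<omega>. min_partial_sum (Suc n) (Z0 \<omega>) - min_partial_sum n (Z1 \<omega>))"
    proof (rule integral_mono)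
      show "integrable M (\<lambda>\<omega>. indicator (N n) \<omega> * Y 0 \<omega>)"
        using integrable_real_mult_indicator[OF N int] by (simp add: mult.commute)
      show "integrable M (\<lambda>\<omega>. min_partial_sum (Suc n) (Z0 \<omega>) - min_partial_sum n (Z1 \<omega>))"
        using int0[of "Suc n"] int1 by (rule Bochner_Integration.integrable_diff)
      show "indicator (N n) \<omega> * Y 0 \<omega> \<le> min_partial_sum (Suc n) (Z0 \<omega>) - min_partial_sum n (Z1 \<omega>)"
        if "\<omega> \<in> space M" for \<omega>
        using that min_partial_sum_le_0[of n "Z1 \<omega>"]
        by (auto simp: N_def Z0_def Z1_def indicator_def min_def)
    qed
    also have "\<dots> = expectation (\<lambda>\<omega>. min_partial_sum (Suc n) (Z0 \<omega>)) - expectation (\<lambda>\<omega>. min_partial_sum n (Z0 \<omega>))"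
      using int0[of "Suc n"] int1[of n] exp1[of n]
      by (subst Bochner_Integration.integral_diff) auto
    also have "\<dots> \<le> 0"
      using integral_mono[OF int0[of "Suc n"] int0[of n]] min_partial_sum_Suc_le by simp
    finally show ?thesis .
  qed
  define B where "B = {\<omega> \<in> space M. \<exists>k::nat. \<forall>n. - real k \<le> (\<Sum>i<n. Y i \<omega>)}"
  have B [measurable]: "B \<in> events" unfolding B_def by measurable
  have incN: "incseq N"
  proof (rule incseq_SucI, unfold N_def, safe)
    fix n \<omega> assume "min_partial_sum (Suc n) (Z0 \<omega>) < 0"
    then show "min_partial_sum (Suc (Suc n)) (Z0 \<omega>) < 0"
      using min_partial_sum_Suc_le[of "Suc n" "Z0 \<omega>"] by linarith
  qed
  have "prob B \<noteq> 0"
  proof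
    assume "prob B = 0"
    have "space M - B \<subseteq> (\<Union>n. N n)"
    proof safe
      fix \<omega> assume \<omega>: "\<omega> \<in> space M" "\<omega> \<notin> B"
      then obtain n where "\<not> - real 0 \<le> (\<Sum>i<n. Y i \<omega>)" unfolding B_def by blast
      then have "min_partial_sum (Suc n) (Z0 \<omega>) < 0"
        using min_partial_sum_le[of n "Suc n" "Z0 \<omega>"] by (simp add: Z0_def)
      then show "\<omega> \<in> (\<Union>n. N n)" using \<omega> by (auto simp: N_def)
    qed
    have "AE \<omega> in M. \<omega> \<notin> B"
      using \<open>prob B = 0\<close> B by (simp add: prob_eq_0)
    then have AE_N: "AE \<omega> in M. \<omega> \<in> (\<Union>n. N n)"
      using AE_space
      by eventually_elim (use \<open>space M - B \<subseteq> (\<Union>n. N n)\<close> in auto)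
    have "(\<lambda>n. indicator (N n) \<omega> * Y 0 \<omega>) \<longlonglongrightarrow> Y 0 \<omega>" if "\<omega> \<in> (\<Union>n. N n)" for \<omega>
    proof -
      have "(\<lambda>n. indicator (N n) \<omega> * Y 0 \<omega>) \<longlonglongrightarrow> indicator (\<Union>n. N n) \<omega> * Y 0 \<omega>"
        by (intro tendsto_mult_right LIMSEQ_indicator_incseq[OF incN])
      then show ?thesis using that by simp
    qed
    with AE_N have lim: "AE \<omega> in M. (\<lambda>n. indicator (N n) \<omega> * Y 0 \<omega>) \<longlonglongrightarrow> Y 0 \<omega>"
      by (rule eventually_mono)
    have "(\<lambda>n. expectation (\<lambda>\<omega>. indicator (N n) \<omega> * Y 0 \<omega>)) \<longlonglongrightarrow> expectation (Y 0)"
    proof (rule integral_dominated_convergence[OF _ _ _ lim])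
      show "integrable M (\<lambda>\<omega>. \<bar>Y 0 \<omega>\<bar>)" using int by simp
      show "AE \<omega> in M. norm (indicator (N n) \<omega> * Y 0 \<omega>) \<le> \<bar>Y 0 \<omega>\<bar>" for n
        by (intro AE_I2) (auto simp: indicator_def)
    qed measurable
    then have "expectation (Y 0) \<le> 0"
      by (rule LIMSEQ_le_const2) (use hopf in auto)
    with pos show False by simp
  qed
  moreover have "prob B = 0 \<or> prob B = 1"
  proof (rule kolmogorov_0_1_law)
    let ?A = "\<lambda>i. sigma_sets (space M) {Y i -` S \<inter> space M |S. S \<in> sets borel}"
    show "sigma_algebra (space M) (?A i)" for i
      by (rule sigma_algebra_sigma_sets) auto
    show "indep_sets ?A UNIV"
      using indep unfolding indep_vars_def by auto
    show "B \<in> tail_events ?A"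
      unfolding tail_events_def
    proof
      fix n :: nat
      \<comment> \<open>\<open>T\<close> is generated by the variables from the \<open>n\<close>th on, and dropping the first \<open>n\<close>
          summands changes the partial sums by a bounded amount only.\<close>
      define T where "T = sigma (space M) (\<Union>i\<in>{n..}. ?A i)"
      have "?A i \<subseteq> Pow (space M)" for i
        using sigma_sets_into_sp[of "{Y i -` S \<inter> space M |S. S \<in> sets borel}" "space M"] by blast
      then have gen: "(\<Union>i\<in>{n..}. ?A i) \<subseteq> Pow (space M)" by blast
      have sp: "space T = space M" and sets_T: "sets T = sigma_sets (space M) (\<Union>i\<in>{n..}. ?A i)"
        unfolding T_def by (simp_all only: space_measure_of[OF gen] sets_measure_of[OF gen])
      have [measurable]: "(\<lambda>\<omega>. Y (n + i) \<omega>) \<in> borel_measurable T" for i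
      proof (rule measurableI)
        fix S :: "real set" assume "S \<in> sets borel"
        then have "Y (n + i) -` S \<inter> space M \<in> ?A (n + i)" by auto
        then show "Y (n + i) -` S \<inter> space T \<in> sets T"
          unfolding sets_T sp by (intro sigma_sets.Basic) (rule UN_I[of "n + i"], auto)
      qed simp
      have split: "(\<Sum>i<n + m. Y i \<omega>) = (\<Sum>i<n. Y i \<omega>) + (\<Sum>i<m. Y (n + i) \<omega>)" for m \<omega>
        by (induction m) auto
      have "B = {\<omega> \<in> space T. \<exists>k::nat. \<forall>m. - real k \<le> (\<Sum>i<m. Y (n + i) \<omega>)}"
      proof (unfold B_def sp, safe)
        fix \<omega> and k :: nat assume *: "\<forall>m. - real k \<le> (\<Sum>i<m. Y i \<omega>)"
        obtain k' :: nat where "(\<Sum>i<n. Y i \<omega>) \<le> real k'" using real_arch_simple by blast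
        moreover have "- real k \<le> (\<Sum>i<n. Y i \<omega>) + (\<Sum>i<m. Y (n + i) \<omega>)" for m
          using *[rule_format, of "n + m"] by (simp only: split)
        ultimately have "- real (k + k') \<le> (\<Sum>i<m. Y (n + i) \<omega>)" for m
          by (smt (verit) of_nat_add)
        then show "\<exists>k::nat. \<forall>m. - real k \<le> (\<Sum>i<m. Y (n + i) \<omega>)" by blast
      next
        fix \<omega> and k :: nat assume *: "\<forall>m. - real k \<le> (\<Sum>i<m. Y (n + i) \<omega>)"
        obtain k' :: nat where k': "(\<Sum>i<n. \<bar>Y i \<omega>\<bar>) \<le> real k'" using real_arch_simple by blast
        have "- real (k + k') \<le> (\<Sum>i<m. Y i \<omega>)" for m
        proof (cases "m \<le> n")
          case True
          have "- (\<Sum>i<m. Y i \<omega>) \<le> (\<Sum>i<m. \<bar>Y i \<omega>\<bar>)"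
            unfolding sum_negf[symmetric] by (intro sum_mono) auto
          also have "\<dots> \<le> (\<Sum>i<n. \<bar>Y i \<omega>\<bar>)" using True by (intro sum_mono2) auto
          finally show ?thesis using k' by simp
        next
          case False
          then obtain j where m: "m = n + j" by (metis le_Suc_ex nat_le_linear)
          have "- (\<Sum>i<n. Y i \<omega>) \<le> (\<Sum>i<n. \<bar>Y i \<omega>\<bar>)"
            unfolding sum_negf[symmetric] by (intro sum_mono) auto
          then show ?thesis using k' *[rule_format, of j] unfolding m split by simp
        qed
        then show "\<exists>k::nat. \<forall>m. - real k \<le> (\<Sum>i<m. Y i \<omega>)" by blast
      qed
      also have "\<dots> \<in> sets T" by measurable
      finally show "B \<in> sigma_sets (space M) (\<Union>i\<in>{n..}. ?A i)"
        unfolding sets_T .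
    qed
  qed
  ultimately have "prob B = 1" by simp
  then have "AE \<omega> in M. \<omega> \<in> B" using B by (simp add: prob_eq_1)
  then show ?thesis
    by (rule AE_mp) (auto intro!: AE_I2 simp: B_def)
qed

text \<open>
  With \<open>b\<close> strictly between \<open>a\<close> and the mean, the partial sums of \<open>Y i - b\<close> are bounded below, and
  \<open>(b - a) * n\<close> eventually absorbs the bound.
\<close>
lemma (in prob_space) strong_law_lower:
  fixes Y :: "nat \<Rightarrow> 'a \<Rightarrow> real"
  assumes indep: "indep_vars (\<lambda>_. borel) Y UNIV"
    and ident: "\<And>i. distr M borel (Y i) = distr M borel (Y 0)"
    and int: "integrable M (Y 0)" and a: "a < expectation (Y 0)"
  shows "AE \<omega> in M. \<forall>\<^sub>F n in sequentially. a * real n \<le> (\<Sum>i<n. Y i \<omega>)"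
proof -
  define b where "b = (a + expectation (Y 0)) / 2"
  have b: "a < b" "b < expectation (Y 0)" using a by (auto simp: b_def field_simps)
  have rv [measurable]: "random_variable borel (Y i)" for i
    using indep unfolding indep_vars_def2 by auto
  have distr_minus: "distr M borel (\<lambda>\<omega>. Y i \<omega> - b) = distr (distr M borel (Y i)) borel (\<lambda>x. x - b)" for i
    by (simp add: distr_distr comp_def)
  have "AE \<omega> in M. \<exists>C. \<forall>n. C \<le> (\<Sum>i<n. Y i \<omega> - b)"
  proof (rule partial_sums_bounded_below)
    show "indep_vars (\<lambda>_. borel) (\<lambda>i \<omega>. Y i \<omega> - b) UNIV"
      using indep_vars_compose[OF indep, of "\<lambda>_ x. x - b" "\<lambda>_. borel"] by (simp add: comp_def)
    show "distr M borel (\<lambda>\<omega>. Y i \<omega> - b) = distr M borel (\<lambda>\<omega>. Y 0 \<omega> - b)" for i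
      unfolding distr_minus ident[of i] ..
    show "integrable M (\<lambda>\<omega>. Y 0 \<omega> - b)" using int by simp
    show "0 < expectation (\<lambda>\<omega>. Y 0 \<omega> - b)" using int b by (simp add: prob_space)
  qed
  then show ?thesis
  proof (rule AE_mp, intro AE_I2 impI)
    fix \<omega> assume "\<exists>C. \<forall>n. C \<le> (\<Sum>i<n. Y i \<omega> - b)"
    then obtain C where C: "C \<le> (\<Sum>i<n. Y i \<omega>) - b * real n" for n
      by (auto simp: sum_subtractf mult.commute)
    have "filterlim (\<lambda>n. (b - a) * real n) at_top sequentially"
      using b by real_asymp
    then have "\<forall>\<^sub>F n in sequentially. - C \<le> (b - a) * real n"
      by (simp add: filterlim_at_top)
    then show "\<forall>\<^sub>F n in sequentially. a * real n \<le> (\<Sum>i<n. Y i \<omega>)"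
    proof eventually_elim
      case (elim n)
      then show ?case using C[of n] by (simp add: algebra_simps)
    qed
  qed
qed

text \<open>
  The lower bound for \<open>Y\<close> and for \<open>- Y\<close>, at countably many distances from the mean.
\<close>
theorem (in prob_space) strong_law_of_large_numbers:
  fixes Y :: "nat \<Rightarrow> 'a \<Rightarrow> real"
  assumes indep: "indep_vars (\<lambda>_. borel) Y UNIV"
    and ident: "\<And>i. distr M borel (Y i) = distr M borel (Y 0)"
    and int: "integrable M (Y 0)"
  shows "AE \<omega> in M. (\<lambda>n. (\<Sum>i<n. Y i \<omega>) / real n) \<longlonglongrightarrow> expectation (Y 0)"
proof -
  let ?\<mu> = "expectation (Y 0)"
  have rv [measurable]: "random_variable borel (Y i)" for i
    using indep unfolding indep_vars_def2 by auto
  have distr_uminus: "distr M borel (\<lambda>\<omega>. - Y i \<omega>) = distr (distr M borel (Y i)) borel uminus" for i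
    by (simp add: distr_distr comp_def)
  have "AE \<omega> in M. \<forall>\<^sub>F n in sequentially. (?\<mu> - 1 / Suc k) * real n \<le> (\<Sum>i<n. Y i \<omega>)" for k
    by (rule strong_law_lower[OF assms]) simp
  moreover have "AE \<omega> in M. \<forall>\<^sub>F n in sequentially. (- ?\<mu> - 1 / Suc k) * real n \<le> (\<Sum>i<n. - Y i \<omega>)" for k
  proof (rule strong_law_lower)
    show "indep_vars (\<lambda>_. borel) (\<lambda>i \<omega>. - Y i \<omega>) UNIV"
      using indep_vars_compose[OF indep, of "\<lambda>_. uminus" "\<lambda>_. borel"] by (simp add: comp_def)
    show "distr M borel (\<lambda>\<omega>. - Y i \<omega>) = distr M borel (\<lambda>\<omega>. - Y 0 \<omega>)" for i
      unfolding distr_uminus ident[of i] ..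
  qed (use int in simp_all)
  ultimately have "AE \<omega> in M. \<forall>k. (\<forall>\<^sub>F n in sequentially. (?\<mu> - 1 / Suc k) * real n \<le> (\<Sum>i<n. Y i \<omega>)) \<and>
      (\<forall>\<^sub>F n in sequentially. (- ?\<mu> - 1 / Suc k) * real n \<le> (\<Sum>i<n. - Y i \<omega>))"
    by (simp add: AE_all_countable)
  then show ?thesis
  proof eventually_elim
    case (elim \<omega>)
    show ?case
    proof (rule tendstoI)
      fix e :: real assume "e > 0"
      then obtain k :: nat where k: "1 / Suc k < e" by (rule nat_approx_posE)
      show "\<forall>\<^sub>F n in sequentially. dist ((\<Sum>i<n. Y i \<omega>) / real n) ?\<mu> < e"
        using elim[rule_format, of k, THEN conjunct1] elim[rule_format, of k, THEN conjunct2] eventually_gt_at_top[of 0]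
      proof eventually_elim
        case (elim n)
        let ?a = "(\<Sum>i<n. Y i \<omega>) / real n"
        have "?\<mu> - 1 / Suc k \<le> ?a" using elim by (simp add: pos_le_divide_eq)
        moreover have "?a \<le> ?\<mu> + 1 / Suc k"
          using elim by (simp add: pos_divide_le_eq sum_negf algebra_simps)
        ultimately show ?case using k unfolding dist_real_def by linarith
      qed
    qed
  qed
qed

section \<open>Means along a random walk and total variation\<close>

text \<open>
  The mean of a function of the state at time \<open>m\<close>. The walk enters the argument only through such
  means, which evolve by the transition operator.
\<close>
definition walk_mean :: "('a, 'b) monoid_scheme \<Rightarrow> ('a \<Rightarrow> real) \<Rightarrow> nat \<Rightarrow> ('a \<Rightarrow> real) \<Rightarrow> real"
  where "walk_mean G Q m \<phi> = (\<Sum>x\<in>carrier G. conv_power G Q m x * \<phi> x)"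

lemma walk_mean_0:
  assumes "group G" "finite (carrier G)"
  shows "walk_mean G Q 0 \<phi> = \<phi> \<one>\<^bsub>G\<^esub>"
proof -
  interpret group G by fact
  show ?thesis
    using assms(2) by (simp add: walk_mean_def if_distrib[of "\<lambda>c. c * _"] cong: if_cong)
qed

lemma walk_mean_Suc:
  assumes "group G" "finite (carrier G)"
  shows "walk_mean G Q (Suc m) \<phi> = walk_mean G Q m (\<lambda>y. \<Sum>z\<in>carrier G. Q z * \<phi> (y \<otimes>\<^bsub>G\<^esub> z))"
proof -
  interpret group G by fact
  have translate: "(\<Sum>x\<in>carrier G. Q (inv\<^bsub>G\<^esub> y \<otimes>\<^bsub>G\<^esub> x) * \<phi> x) = (\<Sum>z\<in>carrier G. Q z * \<phi> (y \<otimes>\<^bsub>G\<^esub> z))"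
    if "y \<in> carrier G" for y
    using that
    by (intro sum.reindex_bij_witness[of _ "\<lambda>z. y \<otimes>\<^bsub>G\<^esub> z" "\<lambda>x. inv\<^bsub>G\<^esub> y \<otimes>\<^bsub>G\<^esub> x"])
       (auto simp flip: m_assoc)
  have "walk_mean G Q (Suc m) \<phi> =
      (\<Sum>x\<in>carrier G. \<Sum>y\<in>carrier G. conv_power G Q m y * (Q (inv\<^bsub>G\<^esub> y \<otimes>\<^bsub>G\<^esub> x) * \<phi> x))"
    by (simp add: walk_mean_def convolution_def sum_distrib_right mult.assoc)
  also have "\<dots> = (\<Sum>y\<in>carrier G. conv_power G Q m y * (\<Sum>x\<in>carrier G. Q (inv\<^bsub>G\<^esub> y \<otimes>\<^bsub>G\<^esub> x) * \<phi> x))"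
    by (subst sum.swap) (simp add: sum_distrib_left)
  finally show ?thesis
    by (simp add: walk_mean_def translate)
qed

lemma walk_mean_eigenfunction:
  assumes "group G" "finite (carrier G)"
    and eigen: "\<And>y. y \<in> carrier G \<Longrightarrow> (\<Sum>z\<in>carrier G. Q z * \<phi> (y \<otimes>\<^bsub>G\<^esub> z)) = c * \<phi> y"
  shows "walk_mean G Q m \<phi> = c ^ m * \<phi> \<one>\<^bsub>G\<^esub>"
proof (induction m)
  case 0
  then show ?case by (simp add: walk_mean_0 assms)
next
  case (Suc m)
  have "walk_mean G Q (Suc m) \<phi> = walk_mean G Q m (\<lambda>y. c * \<phi> y)"
    by (subst walk_mean_Suc[OF assms(1,2)]) (simp add: walk_mean_def eigen)
  also have "\<dots> = c * walk_mean G Q m \<phi>"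
    by (simp add: walk_mean_def sum_distrib_left mult_ac)
  finally show ?case by (simp add: Suc)
qed

lemma conv_power_nonneg:
  assumes "group G" "\<And>x. x \<in> carrier G \<Longrightarrow> 0 \<le> Q x" "x \<in> carrier G"
  shows "0 \<le> conv_power G Q m x"
  using assms(3)
proof (induction m arbitrary: x)
  case (Suc m)
  interpret group G by fact
  show ?case
    using Suc by (auto simp: convolution_def intro!: sum_nonneg mult_nonneg_nonneg assms(2))
qed simp

text \<open>
  The maximum is attained where \<open>f\<close> is nonnegative, and there \<open>f\<close> has half of its total absolute mass
  because the positive and the negative part balance.
\<close>
lemma Max_subset_sum_eq_half_L1:
  fixes f :: "'a \<Rightarrow> real"
  assumes "finite S" "sum f S = 0"
  shows "(MAX E\<in>Pow S. sum f E) = (\<Sum>x\<in>S. \<bar>f x\<bar>) / 2"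
proof -
  define A where "A = {x \<in> S. f x \<ge> 0}"
  have "(\<Sum>x\<in>S. \<bar>f x\<bar>) = (\<Sum>x\<in>S. 2 * (if f x \<ge> 0 then f x else 0) - f x)"
    by (intro sum.cong) auto
  also have "\<dots> = 2 * sum f A"
    using assms by (simp add: sum_subtractf A_def sum.inter_filter flip: sum_distrib_left)
  finally have A: "sum f A = (\<Sum>x\<in>S. \<bar>f x\<bar>) / 2" by simp
  have "sum f E \<le> sum f A" if "E \<subseteq> S" for E
  proof -
    have "sum f E \<le> (\<Sum>x\<in>E. if f x \<ge> 0 then f x else 0)" by (intro sum_mono) auto
    also have "\<dots> \<le> (\<Sum>x\<in>S. if f x \<ge> 0 then f x else 0)"
      using that assms by (intro sum_mono2) auto
    finally show ?thesis using assms by (simp add: A_def sum.inter_filter)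
  qed
  then have "(MAX E\<in>Pow S. sum f E) = sum f A"
    using assms by (intro Max_eqI) (auto simp: A_def)
  with A show ?thesis by simp
qed

lemma d_TV_ge_event:
  assumes "finite (carrier G)" "E \<subseteq> carrier G"
  shows "(\<Sum>x\<in>E. conv_power G Q m x) - real (card E) / real (card (carrier G)) \<le> d_TV G Q m"
  unfolding d_TV_def using assms by (intro Max_ge) auto

lemma d_TV_eq_half_L1:
  assumes "finite (carrier G)" "carrier G \<noteq> {}" "walk_mean G Q m (\<lambda>_. 1) = 1"
  shows "d_TV G Q m = (\<Sum>x\<in>carrier G. \<bar>conv_power G Q m x - 1 / real (card (carrier G))\<bar>) / 2"
proof -
  let ?f = "\<lambda>x. conv_power G Q m x - 1 / real (card (carrier G))"
  have "(\<Sum>x\<in>E. conv_power G Q m x) - real (card E) / real (card (carrier G)) = sum ?f E" for E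
    by (simp add: sum_subtractf)
  then have "d_TV G Q m = (MAX E\<in>Pow (carrier G). sum ?f E)"
    by (simp add: d_TV_def)
  also have "\<dots> = (\<Sum>x\<in>carrier G. \<bar>?f x\<bar>) / 2"
    using assms by (intro Max_subset_sum_eq_half_L1) (auto simp: sum_subtractf walk_mean_def)
  finally show ?thesis .
qed

lemma chebyshev_finite:
  fixes w f :: "'b \<Rightarrow> real"
  assumes "finite S" "\<And>x. x \<in> S \<Longrightarrow> 0 \<le> w x" "a > 0" "E \<subseteq> S"
    and "\<And>x. x \<in> E \<Longrightarrow> a \<le> \<bar>f x\<bar>"
  shows "a\<^sup>2 * (\<Sum>x\<in>E. w x) \<le> (\<Sum>x\<in>S. w x * (f x)\<^sup>2)"
proof -
  have "a\<^sup>2 * (\<Sum>x\<in>E. w x) \<le> (\<Sum>x\<in>E. w x * (f x)\<^sup>2)"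
    unfolding sum_distrib_left
  proof (rule sum_mono)
    fix x assume x: "x \<in> E"
    then have "a\<^sup>2 \<le> (f x)\<^sup>2" using assms(3,5) by (intro abs_le_square_iff[THEN iffD1]) auto
    then show "a\<^sup>2 * w x \<le> w x * (f x)\<^sup>2"
      using assms(2,4) x by (subst mult.commute) (auto intro!: mult_left_mono)
  qed
  also have "\<dots> \<le> (\<Sum>x\<in>S. w x * (f x)\<^sup>2)"
    using assms by (intro sum_mono2) auto
  finally show ?thesis .
qed

section \<open>Trigonometric sums over cyclic groups\<close>

text \<open>
  Multiplied by \<open>2 * sin (\<theta> / 2)\<close>, where \<open>\<theta> = 2 * \<pi> * x / N\<close>, which is nonzero unless
  \<open>N\<close> divides \<open>x\<close>, the sum telescopes to a
  difference of sines at arguments that differ by a multiple of \<open>2 * \<pi>\<close>.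
\<close>
lemma sum_cos_cyclic:
  fixes N :: nat and x :: int
  assumes "N > 0"
  shows "(\<Sum>k\<in>{0..<int N}. cos (2 * pi * of_int (k * x) / N)) = (if int N dvd x then real N else 0)"
proof -
  define \<theta> where "\<theta> = 2 * pi * of_int x / N"
  have "(\<Sum>k\<in>{0..<int N}. cos (2 * pi * of_int (k * x) / N)) = (\<Sum>k<N. cos (real k * \<theta>))"
  proof -
    have "{0..<int N} = int ` {..<N}" by (simp add: lessThan_atLeast0 image_int_atLeastLessThan)
    then show ?thesis by (simp add: sum.reindex \<theta>_def mult_ac)
  qed
  also have "\<dots> = (if int N dvd x then real N else 0)"
  proof (cases "int N dvd x")
    case True
    then obtain q where "x = int N * q" by blast
    then have "cos (real k * \<theta>) = 1" for k
      using assms cos_int_2pin[of "int k * q"] by (simp add: \<theta>_def mult_ac)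
    then show ?thesis using True by simp
  next
    case False
    have "sin (\<theta> / 2) \<noteq> 0"
    proof
      assume "sin (\<theta> / 2) = 0"
      then have "sin (of_int x / N * pi) = 0" by (simp add: \<theta>_def mult_ac)
      then have "real_of_int x / N \<in> \<int>" by (simp only: sin_times_pi_eq_0)
      then obtain q where "real_of_int x / N = of_int q" by (elim Ints_cases)
      then have "real_of_int x = of_int (q * int N)" using assms by (simp add: field_simps)
      then have "x = q * int N" by (simp only: of_int_eq_iff)
      with False show False by simp
    qed
    have "(\<Sum>k<n. 2 * sin (\<theta> / 2) * cos (real k * \<theta>)) = sin ((real n - 1/2) * \<theta>) + sin (\<theta> / 2)" for n :: nat
    proof (induction n)
      case (Suc n)
      have "2 * sin (\<theta> / 2) * cos (real n * \<theta>) = sin ((real (Suc n) - 1/2) * \<theta>) - sin ((real n - 1/2) * \<theta>)"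
        by (simp add: sin_diff_sin algebra_simps add_divide_distrib diff_divide_distrib)
      with Suc show ?case by simp
    qed simp
    from this[of N] have "2 * sin (\<theta> / 2) * (\<Sum>k<N. cos (real k * \<theta>)) = sin ((real N - 1/2) * \<theta>) + sin (\<theta> / 2)"
      by (simp add: sum_distrib_left)
    also have "(real N - 1/2) * \<theta> = of_int x * (2 * pi) - \<theta> / 2"
      using assms by (simp add: \<theta>_def field_simps)
    also have "sin \<dots> = - sin (\<theta> / 2)"
      using sin_int_2pin[of x] cos_int_2pin[of x] by (simp add: sin_diff mult_ac)
    finally show ?thesis using False \<open>sin (\<theta> / 2) \<noteq> 0\<close> by simp
  qed
  finally show ?thesis .
qed

lemma cos_cong_mod:
  fixes N :: nat and k a b :: int
  assumes "N > 0" "a mod int N = b mod int N"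
  shows "cos (2 * pi * of_int (k * a) / N) = cos (2 * pi * of_int (k * b) / N)"
proof -
  obtain q where q: "a = b + int N * q"
    using assms(2) by (metis mod_eq_dvd_iff dvdE add_diff_cancel_left' diff_add_cancel add.commute)
  have "2 * pi * of_int (k * a) / N = 2 * pi * of_int (k * b) / N + of_int (k * q) * (2 * pi)"
    unfolding q using assms(1) by (simp add: field_simps)
  then show ?thesis
    using sin_int_2pin[of "k * q"] cos_int_2pin[of "k * q"] by (simp add: cos_add mult_ac)
qed

text \<open>
  By induction, since \<open>sin\<^sup>2 ((j + 1) * x) - sin\<^sup>2 (j * x) = sin ((2 * j + 1) * x) * sin x\<close> and
  \<open>(2 * j + 1) * x\<close> lies between \<open>x\<close> and \<open>\<pi> - x\<close>, where the sine is at least \<open>sin x\<close>.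
\<close>
lemma sin_squared_multiple_ge:
  assumes "1 \<le> j" "0 \<le> x" "real j * x \<le> pi / 2"
  shows "real j * (sin x)\<^sup>2 \<le> (sin (real j * x))\<^sup>2"
  using assms
proof (induction j rule: nat_induct_at_least)
  case base
  then show ?case by simp
next
  case (Suc j)
  have bounds: "0 \<le> x" "(real j + 1) * x \<le> pi / 2" using Suc.prems by (auto simp: algebra_simps)
  have jx: "1 * x \<le> real j * x" using Suc.hyps \<open>0 \<le> x\<close> by (intro mult_right_mono) auto
  have step: "sin x \<le> sin ((2 * real j + 1) * x)"
  proof (cases "(2 * real j + 1) * x \<le> pi / 2")
    case True
    then show ?thesis
      using bounds jx by (intro sin_monotone_2pi_le) (auto simp: algebra_simps)
  next
    case False
    have "sin x \<le> sin (pi - (2 * real j + 1) * x)"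
      using False bounds jx by (intro sin_monotone_2pi_le) (auto simp: algebra_simps)
    then show ?thesis by simp
  qed
  have sinx: "0 \<le> sin x" using bounds jx by (intro sin_ge_zero) (auto simp: algebra_simps)
  have "(sin (real (Suc j) * x))\<^sup>2 - (sin (real j * x))\<^sup>2 =
      (sin (real (Suc j) * x) + sin (real j * x)) * (sin (real (Suc j) * x) - sin (real j * x))"
    by (simp add: power2_eq_square algebra_simps)
  also have "\<dots> = (2 * sin ((2 * real j + 1) * x / 2) * cos ((2 * real j + 1) * x / 2)) * (2 * sin (x / 2) * cos (x / 2))"
  proof -
    have "real (Suc j) * x + real j * x = (2 * real j + 1) * x" "real (Suc j) * x - real j * x = x"
      by (simp_all add: algebra_simps)
    then show ?thesis by (simp only: sin_plus_sin sin_diff_sin mult_ac)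
  qed
  also have "\<dots> = sin ((2 * real j + 1) * x) * sin x"
    by (simp only: sin_double[symmetric]) simp
  also have "\<dots> \<ge> sin x * sin x"
    using step sinx by (rule mult_right_mono)
  finally have "(sin x)\<^sup>2 \<le> (sin (real (Suc j) * x))\<^sup>2 - (sin (real j * x))\<^sup>2"
    by (simp add: power2_eq_square)
  moreover have "real j * (sin x)\<^sup>2 \<le> (sin (real j * x))\<^sup>2"
    using Suc.IH bounds by (simp add: algebra_simps)
  ultimately show ?case by (simp add: algebra_simps)
qed

lemma sum_power_Suc_le:
  fixes x :: real
  assumes "0 \<le> x" "x < 1"
  shows "(\<Sum>k<n. x ^ Suc k) \<le> x / (1 - x)"
proof -
  have "(\<Sum>k<n. x ^ Suc k) = x * ((1 - x ^ n) / (1 - x))"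
    using assms by (simp add: sum_distrib_left[symmetric] sum_gp_strict)
  also have "\<dots> \<le> x * (1 / (1 - x))"
    using assms by (intro mult_left_mono divide_right_mono) auto
  finally show ?thesis by simp
qed

text \<open>
  The frequencies \<open>k\<close> and \<open>N - k\<close> contribute equally, and by the preceding bound the sum over half
  of the circle is dominated by a geometric series whose ratio is the term at \<open>k = 1\<close>. The bound is
  therefore asymptotically twice the largest term, without a factor growing with \<open>N\<close>; such a factor
  would shift the mixing time by a constant multiple and hide the cutoff.
\<close>
lemma cyclic_exp_sum_le:
  fixes N :: nat and u :: real
  assumes N: "N \<ge> 2" and u: "u > 0"
  shows "(\<Sum>k\<in>{0..<int N}. exp (- u * (sin (pi * of_int k / N))\<^sup>2)) \<le>
    1 + 2 / (exp (u * (sin (pi / N))\<^sup>2) - 1)"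
proof -
  define s where "s = (sin (pi / N))\<^sup>2"
  define x where "x = exp (- u * s)"
  have "sin (pi / N) > 0" using N by (intro sin_gt_zero) (auto simp: field_simps)
  then have s: "s > 0" by (simp add: s_def)
  have x: "0 < x" "x < 1" using u s by (auto simp: x_def)
  have half: "exp (- u * (sin (pi * real k / N))\<^sup>2) \<le> x ^ k" if "1 \<le> k" "2 * k \<le> N" for k :: nat
  proof -
    have "real k * (pi / N) \<le> pi / 2"
    proof -
      have "2 * real k \<le> real N" using that by linarith
      then have "2 * real k * pi \<le> real N * pi" by (intro mult_right_mono) auto
      then show ?thesis using N by (simp add: field_simps)
    qed
    then have "real k * s \<le> (sin (real k * (pi / N)))\<^sup>2"
      unfolding s_def using that by (intro sin_squared_multiple_ge) auto
    then have "- u * (sin (pi * real k / N))\<^sup>2 \<le> real k * (- u * s)"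
      using u by (simp add: mult.commute)
    then show ?thesis
      unfolding x_def exp_of_nat_mult[symmetric] by (simp add: mult.commute)
  qed
  have paired: "exp (- u * (sin (pi * real k / N))\<^sup>2) \<le> x ^ k + x ^ (N - k)" if k: "1 \<le> k" "k < N" for k :: nat
  proof (cases "2 * k \<le> N")
    case True
    then show ?thesis using half[of k] k x by (simp add: add_increasing2)
  next
    case False
    have "pi * real (N - k) / N = pi - pi * real k / N"
      using k N by (simp add: field_simps)
    then have "sin (pi * real (N - k) / N) = sin (pi * real k / N)" by simp
    then show ?thesis using half[of "N - k"] False k x by (simp add: add_increasing)
  qed
  have "(\<Sum>k\<in>{0..<int N}. exp (- u * (sin (pi * of_int k / N))\<^sup>2)) = (\<Sum>k<N. exp (- u * (sin (pi * real k / N))\<^sup>2))"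
  proof -
    have "{0..<int N} = int ` {..<N}" by (simp add: lessThan_atLeast0 image_int_atLeastLessThan)
    then show ?thesis by (simp add: sum.reindex)
  qed
  also have "\<dots> = (\<Sum>k<Suc (N - 1). exp (- u * (sin (pi * real k / N))\<^sup>2))"
    using N by simp
  also have "\<dots> = 1 + (\<Sum>k<N-1. exp (- u * (sin (pi * real (Suc k) / N))\<^sup>2))"
    unfolding sum.lessThan_Suc_shift by simp
  also have "(\<Sum>k<N-1. exp (- u * (sin (pi * real (Suc k) / N))\<^sup>2)) \<le> (\<Sum>k<N-1. x ^ Suc k + x ^ (N - Suc k))"
    by (intro sum_mono paired) auto
  also have "\<dots> = (\<Sum>k<N-1. x ^ Suc k) + (\<Sum>k<N-1. x ^ Suc k)"
  proof -
    have "(\<Sum>k<N-1. x ^ (N - Suc k)) = (\<Sum>k<N-1. x ^ Suc (N - 1 - Suc k))"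
      by (intro sum.cong refl arg_cong[of _ _ "\<lambda>j. x ^ j"]) auto
    also have "\<dots> = (\<Sum>k<N-1. x ^ Suc k)"
      by (rule sum.nat_diff_reindex)
    finally show ?thesis by (simp add: sum.distrib)
  qed
  also have "\<dots> \<le> 2 * (x / (1 - x))"
    using sum_power_Suc_le[of x "N - 1"] x by simp
  also have "x / (1 - x) = 1 / (exp (u * s) - 1)"
    unfolding x_def using u s by (simp add: exp_minus field_simps)
  finally show ?thesis unfolding s_def by simp
qed

section \<open>Products of lazy walks on cycles\<close>

definition gap :: "nat \<Rightarrow> real" where "gap i = (sin (pi / real (i + 2)))\<^sup>2"

lemma gap_pos: "0 < gap i"
  unfolding gap_def by (intro zero_less_power sin_gt_zero) (auto simp: field_simps intro: add_pos_nonneg)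

lemma gap_le_1: "gap i \<le> 1"
  by (simp add: gap_def abs_square_le_1)

lemma gap_asymp: "(\<lambda>i. (real i)\<^sup>2 * gap i) \<longlonglongrightarrow> pi\<^sup>2"
  unfolding gap_def by real_asymp

lemma carrier_zmod_group [simp]: "carrier (zmod_group i) = {0..<int (i + 2)}"
  by (simp add: zmod_group_def carrier_integer_mod_group)

lemma one_zmod_group [simp]: "\<one>\<^bsub>zmod_group i\<^esub> = 0"
  by (simp add: zmod_group_def)

lemma mult_zmod_group [simp]: "x \<otimes>\<^bsub>zmod_group i\<^esub> y = (x + y) mod int (i + 2)"
  by (simp add: zmod_group_def)

lemma group_zmod_group [simp]: "group (zmod_group i)"
  by (simp add: zmod_group_def)

text \<open>
  The step \<open>-1\<close> is represented by the residue \<open>i + 1\<close> modulo \<open>i + 2\<close>, which differs from 1 because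
  \<open>i\<close> is positive.
\<close>
lemma sum_zmod_prob:
  assumes "i \<ge> 1"
  shows "(\<Sum>a\<in>carrier (zmod_group i). zmod_prob i a * g a) = g 0 / 2 + g 1 / 4 + g (int i + 1) / 4"
proof -
  have inv1: "inv\<^bsub>zmod_group i\<^esub> 1 = int i + 1"
  proof -
    have "inv\<^bsub>zmod_group i\<^esub> 1 = (- 1) mod int (i + 2)"
      unfolding zmod_group_def by (rule inv_integer_mod_group) (simp add: carrier_integer_mod_group)
    also have "\<dots> = int i + 1" by (simp add: zmod_minus1)
    finally show ?thesis .
  qed
  have "(\<Sum>a\<in>carrier (zmod_group i). zmod_prob i a * g a) = (\<Sum>a\<in>{0, 1, int i + 1}. zmod_prob i a * g a)"
    using assms by (intro sum.mono_neutral_right) (auto simp: zmod_prob_def inv1)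
  also have "\<dots> = g 0 / 2 + g 1 / 4 + g (int i + 1) / 4"
    using assms by (simp add: zmod_prob_def inv1)
  finally show ?thesis .
qed

lemma sum_lifted_prob:
  assumes "finite (carrier (product_group I G))" "finite (carrier (G i))"
    and "\<And>y. y \<in> carrier (G i) \<Longrightarrow> factor_embed I G i y \<in> carrier (product_group I G)"
  shows "(\<Sum>x\<in>carrier (product_group I G). lifted_prob I G Q i x * \<phi> x) =
    (\<Sum>y\<in>carrier (G i). Q i y * \<phi> (factor_embed I G i y))"
proof -
  have "(\<Sum>x\<in>carrier (product_group I G). lifted_prob I G Q i x * \<phi> x) =
    (\<Sum>x\<in>carrier (product_group I G). \<Sum>y | y \<in> carrier (G i) \<and> factor_embed I G i y = x.
       Q i y * \<phi> (factor_embed I G i y))"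
    by (simp add: lifted_prob_def sum_distrib_right)
  also have "\<dots> = (\<Sum>y\<in>carrier (G i). Q i y * \<phi> (factor_embed I G i y))"
    using assms by (intro sum.group) auto
  finally show ?thesis .
qed

locale lazy_torus_walk =
  fixes n :: nat and r :: "nat \<Rightarrow> real"
  assumes n_pos: "n \<ge> 1"
    and r_pos: "\<And>i. i \<in> {1..n} \<Longrightarrow> 0 < r i"
    and r_sum: "(\<Sum>i=1..n. r i) = 1"
begin

definition G :: "(nat \<Rightarrow> int) monoid" where "G = family_group zmod_group n"

definition Q :: "(nat \<Rightarrow> int) \<Rightarrow> real" where "Q = product_prob {1..n} zmod_group zmod_prob r"

lemma carrier_G: "carrier G = (\<Pi>\<^sub>E i\<in>{1..n}. {0..<int (i + 2)})"
  unfolding G_def family_group_def by simp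

lemma finite_G: "finite (carrier G)"
  unfolding carrier_G by (intro finite_PiE) auto

lemma group_G: "group G"
  unfolding G_def family_group_def by (rule product_group) simp

lemma one_G: "\<one>\<^bsub>G\<^esub> = (\<lambda>i\<in>{1..n}. 0)"
  unfolding G_def family_group_def by simp

lemma carrier_G_nonempty: "carrier G \<noteq> {}"
  using group.is_monoid[OF group_G] monoid.one_closed by fastforce

lemma zmod_prob_nonneg: "0 \<le> zmod_prob i a"
  by (simp add: zmod_prob_def)

lemma Q_nonneg: "0 \<le> Q x"
  unfolding Q_def product_prob_def lifted_prob_def
  by (intro sum_nonneg mult_nonneg_nonneg zmod_prob_nonneg less_imp_le[OF r_pos])

lemma one_step_mean:
  assumes y: "y \<in> carrier G"
  shows "(\<Sum>z\<in>carrier G. Q z * \<phi> (y \<otimes>\<^bsub>G\<^esub> z)) = (\<Sum>i=1..n. r i *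
     (\<phi> y / 2 + \<phi> (y(i := (y i + 1) mod int (i + 2))) / 4 + \<phi> (y(i := (y i - 1) mod int (i + 2))) / 4))"
proof -
  have embed: "y \<otimes>\<^bsub>G\<^esub> factor_embed {1..n} zmod_group i a = y(i := (y i + a) mod int (i + 2))"
    if "i \<in> {1..n}" for i a
    using that y unfolding G_def family_group_def
    by (auto simp: factor_embed_def fun_eq_iff PiE_iff extensional_def)
  have embed_carrier: "factor_embed {1..n} zmod_group i a \<in> carrier (product_group {1..n} zmod_group)"
    if "a \<in> carrier (zmod_group i)" for i a
    using that by (auto simp: factor_embed_def)
  have "(\<Sum>z\<in>carrier G. Q z * \<phi> (y \<otimes>\<^bsub>G\<^esub> z)) =
     (\<Sum>i=1..n. r i * (\<Sum>z\<in>carrier G. lifted_prob {1..n} zmod_group zmod_prob i z * \<phi> (y \<otimes>\<^bsub>G\<^esub> z)))"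
    unfolding Q_def product_prob_def sum_distrib_right sum_distrib_left
    by (subst sum.swap) (simp add: mult.assoc)
  also have "\<dots> = (\<Sum>i=1..n. r i * (\<Sum>a\<in>carrier (zmod_group i). zmod_prob i a * \<phi> (y(i := (y i + a) mod int (i + 2)))))"
  proof (intro sum.cong refl arg_cong2[of _ _ _ _ times])
    fix i assume i: "i \<in> {1..n}"
    have "(\<Sum>z\<in>carrier G. lifted_prob {1..n} zmod_group zmod_prob i z * \<phi> (y \<otimes>\<^bsub>G\<^esub> z)) =
       (\<Sum>a\<in>carrier (zmod_group i). zmod_prob i a * \<phi> (y \<otimes>\<^bsub>G\<^esub> factor_embed {1..n} zmod_group i a))"
      using sum_lifted_prob[of "{1..n}" zmod_group i zmod_prob "\<lambda>z. \<phi> (y \<otimes>\<^bsub>G\<^esub> z)"]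
        finite_G embed_carrier unfolding G_def family_group_def by simp
    then show "(\<Sum>z\<in>carrier G. lifted_prob {1..n} zmod_group zmod_prob i z * \<phi> (y \<otimes>\<^bsub>G\<^esub> z)) =
        (\<Sum>a\<in>carrier (zmod_group i). zmod_prob i a * \<phi> (y(i := (y i + a) mod int (i + 2))))"
      by (simp only: embed[OF i])
  qed
  also have "\<dots> = (\<Sum>i=1..n. r i *
     (\<phi> y / 2 + \<phi> (y(i := (y i + 1) mod int (i + 2))) / 4 + \<phi> (y(i := (y i - 1) mod int (i + 2))) / 4))"
  proof (intro sum.cong refl arg_cong2[of _ _ _ _ times])
    fix i assume i: "i \<in> {1..n}"
    then have "y i \<in> {0..<int (i + 2)}" using y unfolding carrier_G by (rule PiE_mem[rotated])
    then have "y(i := (y i + 0) mod int (i + 2)) = y" by (auto simp: fun_eq_iff)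
    moreover have "(y i + (int i + 1)) mod int (i + 2) = (y i - 1) mod int (i + 2)"
      by (subst mod_add_self2[symmetric]) (simp add: algebra_simps)
    ultimately show "(\<Sum>a\<in>carrier (zmod_group i). zmod_prob i a * \<phi> (y(i := (y i + a) mod int (i + 2)))) =
       \<phi> y / 2 + \<phi> (y(i := (y i + 1) mod int (i + 2))) / 4 + \<phi> (y(i := (y i - 1) mod int (i + 2))) / 4"
      using i by (subst sum_zmod_prob) simp_all
  qed
  finally show ?thesis .
qed

text \<open>
  The frequency \<open>k\<close> ranges over the carrier of the group itself, which serves as its own dual. The
  phase \<open>x\<close> makes it possible to write the indicator of the point \<open>x\<close> as a sum of waves, and the
  real form is available because the walk is symmetric in each coordinate.
\<close>
definition wave :: "(nat \<Rightarrow> int) \<Rightarrow> (nat \<Rightarrow> int) \<Rightarrow> (nat \<Rightarrow> int) \<Rightarrow> real"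
  where "wave k x y = (\<Prod>i=1..n. cos (2 * pi * of_int (k i * (y i - x i)) / real (i + 2)))"

definition eigenvalue :: "(nat \<Rightarrow> int) \<Rightarrow> real"
  where "eigenvalue k = (\<Sum>i=1..n. r i * (cos (pi * of_int (k i) / real (i + 2)))\<^sup>2)"

text \<open>
  In one coordinate, with \<open>\<alpha>\<close> the argument of the cosine and \<open>\<beta> = \<pi> * k i / (i + 2)\<close>, this is
  \<open>cos \<alpha> / 2 + cos (\<alpha> + 2 * \<beta>) / 4 + cos (\<alpha> - 2 * \<beta>) / 4 = cos\<^sup>2 \<beta> * cos \<alpha>\<close>.
\<close>
lemma wave_eigenfunction:
  assumes y: "y \<in> carrier G"
  shows "(\<Sum>z\<in>carrier G. Q z * wave k x (y \<otimes>\<^bsub>G\<^esub> z)) = eigenvalue k * wave k x y"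
  unfolding one_step_mean[OF y] eigenvalue_def sum_distrib_right
proof (intro sum.cong refl)
  fix i assume i: "i \<in> {1..n}"
  define c where "c j b = cos (2 * pi * of_int (k j * (b - x j)) / real (j + 2))" for j b
  define R where "R = (\<Prod>j\<in>{1..n}-{i}. c j (y j))"
  have wave: "wave k x (y(i := b)) = c i b * R" for b
  proof -
    have "wave k x (y(i := b)) = c i b * (\<Prod>j\<in>{1..n}-{i}. c j ((y(i := b)) j))"
      unfolding wave_def c_def[symmetric] using i by (subst prod.remove[of _ i]) auto
    then show ?thesis unfolding R_def by simp
  qed
  have shift: "c i ((y i + d) mod int (i + 2)) = c i (y i + d)" for d
    unfolding c_def by (rule cos_cong_mod) (simp_all add: mod_diff_left_eq)
  define \<alpha> where "\<alpha> = 2 * pi * of_int (k i * (y i - x i)) / real (i + 2)"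
  define \<beta> where "\<beta> = pi * of_int (k i) / real (i + 2)"
  have cosines: "c i (y i) = cos \<alpha>" "c i (y i + 1) = cos (\<alpha> + 2 * \<beta>)" "c i (y i - 1) = cos (\<alpha> - 2 * \<beta>)"
    unfolding c_def \<alpha>_def \<beta>_def by (auto intro!: arg_cong[of _ _ cos] simp: add_divide_distrib diff_divide_distrib algebra_simps)
  then have "c i (y i) / 2 + c i (y i + 1) / 4 + c i (y i - 1) / 4 = cos \<alpha> * (1 / 2 + cos (2 * \<beta>) / 2)"
    unfolding cosines cos_add cos_diff by (simp add: field_simps)
  also have "\<dots> = cos \<alpha> * (cos \<beta>)\<^sup>2"
    unfolding cos_double_cos by (simp add: field_simps)
  finally have "c i (y i) / 2 + c i (y i + 1) / 4 + c i (y i - 1) / 4 = (cos \<beta>)\<^sup>2 * c i (y i)"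
    using cosines by simp
  then have "(c i (y i) / 2 + c i (y i + 1) / 4 + c i (y i - 1) / 4) * R = (cos \<beta>)\<^sup>2 * (c i (y i) * R)"
    by (simp add: mult.assoc)
  moreover have "wave k x y = c i (y i) * R" using wave[of "y i"] by simp
  ultimately show "r i * (wave k x y / 2 + wave k x (y(i := (y i + 1) mod int (i + 2))) / 4 +
      wave k x (y(i := (y i - 1) mod int (i + 2))) / 4) =
    r i * (cos (pi * of_int (k i) / real (i + 2)))\<^sup>2 * wave k x y"
    using shift[of 1] shift[of "-1"] unfolding wave \<beta>_def[symmetric] by (simp add: algebra_simps)
qed

lemma walk_mean_wave: "walk_mean G Q m (wave k x) = eigenvalue k ^ m * wave k x \<one>\<^bsub>G\<^esub>"
  by (rule walk_mean_eigenfunction[OF group_G finite_G wave_eigenfunction])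

lemma eigenvalue_nonneg: "0 \<le> eigenvalue k"
  unfolding eigenvalue_def by (intro sum_nonneg mult_nonneg_nonneg less_imp_le[OF r_pos]) auto

lemma eigenvalue_eq: "eigenvalue k = 1 - (\<Sum>i=1..n. r i * (sin (pi * of_int (k i) / real (i + 2)))\<^sup>2)"
proof -
  have "eigenvalue k = (\<Sum>i=1..n. r i - r i * (sin (pi * of_int (k i) / real (i + 2)))\<^sup>2)"
    unfolding eigenvalue_def by (intro sum.cong refl) (simp add: cos_squared_eq algebra_simps)
  then show ?thesis using r_sum by (simp add: sum_subtractf)
qed

text \<open>
  This is the wave whose frequency is the indicator of \<open>J\<close>. The cases of none, one and two elements
  give the total mass, the first and the second moments used below.
\<close>
lemma walk_mean_prod_cos:
  assumes J: "J \<subseteq> {1..n}"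
  shows "walk_mean G Q m (\<lambda>y. \<Prod>j\<in>J. cos (2 * pi * of_int (y j) / real (j + 2))) = (1 - (\<Sum>j\<in>J. r j * gap j)) ^ m"
proof -
  define k :: "nat \<Rightarrow> int" where "k = (\<lambda>j. if j \<in> J then 1 else 0)"
  have wave: "wave k (\<lambda>_. 0) y = (\<Prod>j\<in>J. cos (2 * pi * of_int (y j) / real (j + 2)))" for y
    unfolding wave_def k_def using J
    by (intro prod.mono_neutral_cong_right) auto
  have "(\<Sum>i=1..n. r i * (sin (pi * of_int (k i) / real (i + 2)))\<^sup>2) = (\<Sum>j\<in>J. r j * gap j)"
    unfolding k_def gap_def using J
    by (intro sum.mono_neutral_cong_right) auto
  then have eig: "eigenvalue k = 1 - (\<Sum>j\<in>J. r j * gap j)" by (simp add: eigenvalue_eq)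
  have "wave k (\<lambda>_. 0) \<one>\<^bsub>G\<^esub> = 1" unfolding wave_def one_G by simp
  then show ?thesis
    using walk_mean_wave[of m k "\<lambda>_. 0"] unfolding wave eig by simp
qed

lemma walk_mean_1: "walk_mean G Q m (\<lambda>_. 1) = 1"
  using walk_mean_prod_cos[of "{}" m] by simp

lemma uniform_sum_prod_cos:
  assumes J: "J \<subseteq> {1..n}" "J \<noteq> {}"
  shows "(\<Sum>y\<in>carrier G. \<Prod>j\<in>J. cos (2 * pi * of_int (y j) / real (j + 2))) = 0"
proof -
  obtain j where j: "j \<in> J" "j \<in> {1..n}" using J by blast
  let ?c = "\<lambda>i b. if i \<in> J then cos (2 * pi * of_int b / real (i + 2)) else 1"
  have "(\<Sum>y\<in>carrier G. \<Prod>j\<in>J. cos (2 * pi * of_int (y j) / real (j + 2))) =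
      (\<Sum>y\<in>carrier G. \<Prod>i\<in>{1..n}. ?c i (y i))"
    using J by (intro sum.cong refl prod.mono_neutral_cong_left) auto
  also have "\<dots> = (\<Prod>i\<in>{1..n}. \<Sum>b\<in>{0..<int (i + 2)}. ?c i b)"
    unfolding carrier_G by (subst prod_sum_PiE) auto
  also have "\<dots> = 0"
  proof (rule prod_zero)
    have "\<not> int (j + 2) dvd 1"
      by (metis One_nat_def add_2_eq_Suc' int_dvd_int_iff nat_dvd_1_iff_1 of_nat_1 old.nat.inject zero_neq_one nat.simps(3))
    then have "(\<Sum>b\<in>{0..<int (j + 2)}. ?c j b) = 0"
      using sum_cos_cyclic[of "j + 2" 1] j by simp
    then show "\<exists>i\<in>{1..n}. (\<Sum>b\<in>{0..<int (i + 2)}. ?c i b) = 0" using j by blast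
  qed simp
  finally show ?thesis .
qed

lemma sum_wave_frequencies:
  assumes "x \<in> carrier G" "y \<in> carrier G"
  shows "(\<Sum>k\<in>carrier G. wave k x y) = (if x = y then real (card (carrier G)) else 0)"
proof -
  have card: "real (card (carrier G)) = (\<Prod>i\<in>{1..n}. real (i + 2))"
    unfolding carrier_G by (simp add: card_PiE)
  have "(\<Sum>k\<in>carrier G. wave k x y) = (\<Prod>i\<in>{1..n}. \<Sum>b\<in>{0..<int (i + 2)}. cos (2 * pi * of_int (b * (y i - x i)) / real (i + 2)))"
    unfolding carrier_G wave_def by (subst prod_sum_PiE) auto
  also have "\<dots> = (\<Prod>i\<in>{1..n}. if int (i + 2) dvd y i - x i then real (i + 2) else 0)"
    by (intro prod.cong refl sum_cos_cyclic) simp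
  also have "\<dots> = (if x = y then real (card (carrier G)) else 0)"
  proof (cases "x = y")
    case True
    then show ?thesis by (simp add: card)
  next
    case False
    then obtain i where i: "i \<in> {1..n}" "x i \<noteq> y i"
      using assms unfolding carrier_G by (meson PiE_ext)
    then have "x i \<in> {0..<int (i + 2)}" "y i \<in> {0..<int (i + 2)}"
      using assms unfolding carrier_G by (auto simp: PiE_iff)
    then have "\<not> int (i + 2) dvd y i - x i"
      using i(2) zdvd_not_zless[of "y i - x i" "int (i + 2)"] zdvd_not_zless[of "x i - y i" "int (i + 2)"]
      by (auto simp: dvd_diff_commute) (smt (verit) dvd_diff_commute)+
    then show ?thesis using i False by (auto intro!: prod_zero)
  qed
  finally show ?thesis .
qed

text \<open>
  The mass at \<open>x\<close> is the mean of the indicator of \<open>x\<close>, a normalized sum of the waves with phase \<open>x\<close>.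
\<close>
lemma conv_power_fourier:
  assumes x: "x \<in> carrier G"
  shows "real (card (carrier G)) * conv_power G Q m x = (\<Sum>k\<in>carrier G. eigenvalue k ^ m * wave k \<one>\<^bsub>G\<^esub> x)"
proof -
  have "(\<Sum>k\<in>carrier G. eigenvalue k ^ m * wave k \<one>\<^bsub>G\<^esub> x) = (\<Sum>k\<in>carrier G. walk_mean G Q m (wave k x))"
  proof (intro sum.cong refl)
    fix k
    have "wave k x \<one>\<^bsub>G\<^esub> = wave k \<one>\<^bsub>G\<^esub> x"
      unfolding wave_def
    proof (intro prod.cong refl)
      fix i
      have "2 * pi * of_int (k i * (\<one>\<^bsub>G\<^esub> i - x i)) / real (i + 2) = - (2 * pi * of_int (k i * (x i - \<one>\<^bsub>G\<^esub> i)) / real (i + 2))"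
        by (simp add: algebra_simps add_divide_distrib diff_divide_distrib)
      then show "cos (2 * pi * of_int (k i * (\<one>\<^bsub>G\<^esub> i - x i)) / real (i + 2)) = cos (2 * pi * of_int (k i * (x i - \<one>\<^bsub>G\<^esub> i)) / real (i + 2))"
        by (simp only: cos_minus)
    qed
    then show "eigenvalue k ^ m * wave k \<one>\<^bsub>G\<^esub> x = walk_mean G Q m (wave k x)"
      by (simp add: walk_mean_wave)
  qed
  also have "\<dots> = (\<Sum>y\<in>carrier G. conv_power G Q m y * (\<Sum>k\<in>carrier G. wave k x y))"
    unfolding walk_mean_def sum_distrib_left by (rule sum.swap)
  also have "\<dots> = (\<Sum>y\<in>carrier G. if x = y then conv_power G Q m y * real (card (carrier G)) else 0)"
    by (intro sum.cong refl) (simp add: sum_wave_frequencies x)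
  also have "\<dots> = real (card (carrier G)) * conv_power G Q m x"
    using x finite_G by simp
  finally show ?thesis by simp
qed

text \<open>
  Fourier inversion replaces one of the two factors by waves, whose means are again powers of the
  eigenvalues.
\<close>
lemma plancherel:
  "real (card (carrier G)) * (\<Sum>x\<in>carrier G. (conv_power G Q m x)\<^sup>2) = (\<Sum>k\<in>carrier G. eigenvalue k ^ (2 * m))"
proof -
  have "real (card (carrier G)) * (\<Sum>x\<in>carrier G. (conv_power G Q m x)\<^sup>2) =
      (\<Sum>x\<in>carrier G. conv_power G Q m x * (\<Sum>k\<in>carrier G. eigenvalue k ^ m * wave k \<one>\<^bsub>G\<^esub> x))"
    unfolding sum_distrib_left[of "real (card (carrier G))"]
    by (intro sum.cong refl) (simp add: conv_power_fourier[symmetric] power2_eq_square)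
  also have "\<dots> = (\<Sum>k\<in>carrier G. eigenvalue k ^ m * walk_mean G Q m (wave k \<one>\<^bsub>G\<^esub>))"
    unfolding walk_mean_def sum_distrib_left by (subst sum.swap) (simp add: mult_ac)
  also have "\<dots> = (\<Sum>k\<in>carrier G. eigenvalue k ^ (2 * m))"
  proof (intro sum.cong refl)
    fix k
    have "wave k \<one>\<^bsub>G\<^esub> \<one>\<^bsub>G\<^esub> = 1" by (simp add: wave_def)
    then show "eigenvalue k ^ m * walk_mean G Q m (wave k \<one>\<^bsub>G\<^esub>) = eigenvalue k ^ (2 * m)"
      unfolding walk_mean_wave by (simp add: mult_2 power_add)
  qed
  finally show ?thesis .
qed

lemma d_TV_half_L1:
  "d_TV G Q m = (\<Sum>x\<in>carrier G. \<bar>conv_power G Q m x - 1 / real (card (carrier G))\<bar>) / 2"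
  by (rule d_TV_eq_half_L1[OF finite_G carrier_G_nonempty walk_mean_1])

text \<open>
  By the Cauchy-Schwarz inequality, and since the constant frequency contributes exactly 1.
\<close>
lemma d_TV_le_spectral: "4 * (d_TV G Q m)\<^sup>2 \<le> (\<Sum>k\<in>carrier G. eigenvalue k ^ (2 * m)) - 1"
proof -
  let ?c = "real (card (carrier G))"
  have c: "?c > 0" using finite_G carrier_G_nonempty by (simp add: card_gt_0_iff)
  have "4 * (d_TV G Q m)\<^sup>2 = (\<Sum>x\<in>carrier G. \<bar>conv_power G Q m x - 1 / ?c\<bar>)\<^sup>2"
    unfolding d_TV_half_L1 by (simp add: power_divide)
  also have "\<dots> \<le> ?c * (\<Sum>x\<in>carrier G. \<bar>conv_power G Q m x - 1 / ?c\<bar>\<^sup>2)"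
    using sum_squared_le_sum_of_squares[of "\<lambda>x. \<bar>conv_power G Q m x - 1 / ?c\<bar>" "carrier G"] finite_G
    by (simp add: mult.commute)
  also have "(\<Sum>x\<in>carrier G. \<bar>conv_power G Q m x - 1 / ?c\<bar>\<^sup>2) =
      (\<Sum>x\<in>carrier G. (conv_power G Q m x)\<^sup>2 - 2 / ?c * (conv_power G Q m x * 1) + 1 / ?c\<^sup>2)"
    by (intro sum.cong refl) (simp add: power2_diff power_divide)
  also have "\<dots> = (\<Sum>x\<in>carrier G. (conv_power G Q m x)\<^sup>2) - 2 / ?c * walk_mean G Q m (\<lambda>_. 1) + ?c * (1 / ?c\<^sup>2)"
    by (simp add: sum.distrib sum_subtractf walk_mean_def flip: sum_distrib_left sum_divide_distrib)
  also have "?c * \<dots> = (\<Sum>k\<in>carrier G. eigenvalue k ^ (2 * m)) - 1"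
    using c plancherel[of m] by (simp add: walk_mean_1 algebra_simps power2_eq_square)
  finally show ?thesis .
qed

text \<open>
  The bound \<open>eigenvalue k \<le> exp (- (1 - eigenvalue k))\<close> makes the sum over all frequencies factor
  over the coordinates, as for the continuous-time walk.
\<close>
lemma d_TV_upper:
  assumes m: "m \<ge> 1"
  shows "4 * (d_TV G Q m)\<^sup>2 \<le> exp (\<Sum>i=1..n. 2 / (exp (2 * real m * r i * gap i) - 1)) - 1"
proof -
  have "(\<Sum>k\<in>carrier G. eigenvalue k ^ (2 * m)) \<le>
     (\<Sum>k\<in>carrier G. \<Prod>i\<in>{1..n}. exp (- (2 * real m * r i) * (sin (pi * of_int (k i) / real (i + 2)))\<^sup>2))"
  proof (rule sum_mono)
    fix k
    let ?s = "\<Sum>i=1..n. r i * (sin (pi * of_int (k i) / real (i + 2)))\<^sup>2"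
    have "eigenvalue k \<le> exp (- ?s)"
      using exp_ge_add_one_self[of "- ?s"] by (simp add: eigenvalue_eq)
    then have "eigenvalue k ^ (2 * m) \<le> exp (- ?s) ^ (2 * m)"
      by (intro power_mono eigenvalue_nonneg)
    also have "\<dots> = exp (\<Sum>i=1..n. - (2 * real m * r i) * (sin (pi * of_int (k i) / real (i + 2)))\<^sup>2)"
      by (simp add: exp_of_nat_mult[symmetric] sum_distrib_left sum_negf mult_ac)
    finally show "eigenvalue k ^ (2 * m) \<le> (\<Prod>i\<in>{1..n}. exp (- (2 * real m * r i) * (sin (pi * of_int (k i) / real (i + 2)))\<^sup>2))"
      by (simp add: exp_sum)
  qed
  also have "\<dots> = (\<Prod>i\<in>{1..n}. \<Sum>b\<in>{0..<int (i + 2)}. exp (- (2 * real m * r i) * (sin (pi * of_int b / real (i + 2)))\<^sup>2))"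
    unfolding carrier_G by (subst prod_sum_PiE) auto
  also have "\<dots> \<le> (\<Prod>i\<in>{1..n}. exp (2 / (exp (2 * real m * r i * gap i) - 1)))"
  proof (intro prod_mono conjI)
    fix i assume i: "i \<in> {1..n}"
    have "(\<Sum>b\<in>{0..<int (i + 2)}. exp (- (2 * real m * r i) * (sin (pi * of_int b / real (i + 2)))\<^sup>2)) \<le>
       1 + 2 / (exp (2 * real m * r i * gap i) - 1)"
      unfolding gap_def using i m r_pos by (intro cyclic_exp_sum_le) auto
    also have "\<dots> \<le> exp (2 / (exp (2 * real m * r i * gap i) - 1))"
      by (rule exp_ge_add_one_self)
    finally show "(\<Sum>b\<in>{0..<int (i + 2)}. exp (- (2 * real m * r i) * (sin (pi * of_int b / real (i + 2)))\<^sup>2)) \<le>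
      exp (2 / (exp (2 * real m * r i * gap i) - 1))" .
  qed (auto intro: sum_nonneg)
  also have "\<dots> = exp (\<Sum>i=1..n. 2 / (exp (2 * real m * r i * gap i) - 1))"
    by (simp add: exp_sum)
  finally show ?thesis using d_TV_le_spectral[of m] by linarith
qed

lemma d_TV_ge_test_function:
  assumes "\<And>y. y \<in> carrier G \<Longrightarrow> \<bar>\<phi> y\<bar> \<le> 1" "(\<Sum>y\<in>carrier G. \<phi> y) = 0"
  shows "walk_mean G Q m \<phi> / 2 \<le> d_TV G Q m"
proof -
  let ?c = "real (card (carrier G))"
  have "walk_mean G Q m \<phi> = (\<Sum>x\<in>carrier G. (conv_power G Q m x - 1 / ?c) * \<phi> x)"
    using assms(2) by (simp add: walk_mean_def left_diff_distrib sum_subtractf flip: sum_divide_distrib)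
  also have "\<dots> \<le> (\<Sum>x\<in>carrier G. \<bar>conv_power G Q m x - 1 / ?c\<bar>)"
  proof (rule sum_mono)
    fix x assume "x \<in> carrier G"
    have "(conv_power G Q m x - 1 / ?c) * \<phi> x \<le> \<bar>conv_power G Q m x - 1 / ?c\<bar> * \<bar>\<phi> x\<bar>"
      unfolding abs_mult[symmetric] by (rule abs_ge_self)
    also have "\<dots> \<le> \<bar>conv_power G Q m x - 1 / ?c\<bar>"
      using assms(1)[OF \<open>x \<in> carrier G\<close>] by (simp add: mult_left_le)
    finally show "(conv_power G Q m x - 1 / ?c) * \<phi> x \<le> \<bar>conv_power G Q m x - 1 / ?c\<bar>" .
  qed
  finally show ?thesis by (simp add: d_TV_half_L1)
qed

lemma d_TV_lower_one_coordinate: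
  assumes "i \<in> {1..n}"
  shows "(1 - r i * gap i) ^ m / 2 \<le> d_TV G Q m"
  using d_TV_ge_test_function[of "\<lambda>y. \<Prod>j\<in>{i}. cos (2 * pi * of_int (y j) / real (j + 2))" m]
    walk_mean_prod_cos[of "{i}" m] uniform_sum_prod_cos[of "{i}"] assms
  by simp

text \<open>
  The test function is the sum \<open>f\<close> of one cosine for each coordinate in \<open>J\<close>. Its mean \<open>\<mu>\<close> is at
  least \<open>card J * (1 - \<rho>) ^ m\<close>. With \<open>a i = r i * gap i\<close>, two different cosines are negatively correlated,
  because \<open>1 - a i - a j \<le> (1 - a i) * (1 - a j)\<close>, and so the variance is at most \<open>card J\<close>. Under the uniform
  distribution \<open>f\<close> has mean 0 and second moment at most \<open>card J\<close>. By Chebyshev's inequality the event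
  \<open>f > \<mu> / 2\<close> has nearly full probability for the walk and small uniform probability.
\<close>
lemma d_TV_lower_many_coordinates:
  assumes J: "J \<subseteq> {1..n}" "J \<noteq> {}" and \<rho>: "\<And>j. j \<in> J \<Longrightarrow> r j * gap j \<le> \<rho>" "\<rho> < 1"
  shows "1 - 8 / (real (card J) * (1 - \<rho>) ^ (2 * m)) \<le> d_TV G Q m"
proof -
  let ?c = "real (card (carrier G))"
  have c: "?c > 0" using finite_G carrier_G_nonempty by (simp add: card_gt_0_iff)
  have finJ: "finite J" using J(1) finite_subset by blast
  have cardJ: "real (card J) > 0" using finJ J(2) by (simp add: card_gt_0_iff)
  define h where "h j y = cos (2 * pi * of_int (y j) / real (j + 2))" for j and y :: "nat \<Rightarrow> int"
  define f where "f y = (\<Sum>j\<in>J. h j y)" for y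
  define a where "a j = r j * gap j" for j
  have gap_le: "0 \<le> gap j" "gap j \<le> 1" for j
    using gap_pos[of j] gap_le_1[of j] by simp_all
  have a_nonneg: "0 \<le> a j" if "j \<in> J" for j
    unfolding a_def using J(1) that r_pos gap_le by (intro mult_nonneg_nonneg less_imp_le[OF r_pos]) auto
  have a_le_r: "a j \<le> r j" if "j \<in> J" for j
    unfolding a_def using J(1) that gap_le by (intro mult_left_le less_imp_le[OF r_pos]) auto
  have pair_le: "a i + a j \<le> 1" if "i \<in> J" "j \<in> J" "i \<noteq> j" for i j
  proof -
    have "a i + a j \<le> r i + r j" using that a_le_r by (intro add_mono) auto
    also have "\<dots> = (\<Sum>k\<in>{i, j}. r k)" using that by simp
    also have "\<dots> \<le> (\<Sum>k=1..n. r k)" using that J(1) less_imp_le[OF r_pos] by (intro sum_mono2) auto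
    finally show ?thesis unfolding r_sum .
  qed
  define \<mu> where "\<mu> = walk_mean G Q m f"
  have mean_h: "walk_mean G Q m (h j) = (1 - a j) ^ m" if "j \<in> J" for j
    using walk_mean_prod_cos[of "{j}" m] that J(1) unfolding h_def a_def by auto
  have \<mu>_eq: "\<mu> = (\<Sum>j\<in>J. (1 - a j) ^ m)"
  proof -
    have "\<mu> = (\<Sum>j\<in>J. walk_mean G Q m (h j))"
      unfolding \<mu>_def f_def walk_mean_def sum_distrib_left by (rule sum.swap)
    then show ?thesis by (simp add: mean_h)
  qed
  have \<mu>_ge: "real (card J) * (1 - \<rho>) ^ m \<le> \<mu>"
  proof -
    have "real (card J) * (1 - \<rho>) ^ m = (\<Sum>j\<in>J. (1 - \<rho>) ^ m)" by simp
    also have "\<dots> \<le> \<mu>" unfolding \<mu>_eq using \<rho> by (intro sum_mono power_mono) (auto simp: a_def)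
    finally show ?thesis .
  qed
  have \<mu>_pos: "\<mu> > 0"
    using \<mu>_ge cardJ \<rho>(2) by (smt (verit) mult_pos_pos zero_less_power)
  have P_nonneg: "0 \<le> conv_power G Q m x" if "x \<in> carrier G" for x
    using conv_power_nonneg[OF group_G Q_nonneg that] .
  have second_moment: "walk_mean G Q m (\<lambda>y. (f y)\<^sup>2) \<le> real (card J) + \<mu>\<^sup>2"
  proof -
    have "walk_mean G Q m (\<lambda>y. (f y)\<^sup>2) = (\<Sum>x\<in>carrier G. \<Sum>i\<in>J. \<Sum>j\<in>J. conv_power G Q m x * (h i x * h j x))"
      unfolding walk_mean_def
    proof (rule sum.cong[OF refl])
      fix x
      have "(f x)\<^sup>2 = (\<Sum>i\<in>J. \<Sum>j\<in>J. h i x * h j x)"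
        by (simp add: f_def power2_eq_square sum_product)
      then show "conv_power G Q m x * (f x)\<^sup>2 = (\<Sum>i\<in>J. \<Sum>j\<in>J. conv_power G Q m x * (h i x * h j x))"
        by (simp add: sum_distrib_left)
    qed
    also have "\<dots> = (\<Sum>i\<in>J. \<Sum>j\<in>J. walk_mean G Q m (\<lambda>x. h i x * h j x))"
      unfolding walk_mean_def by (subst sum.swap) (intro sum.cong refl sum.swap)
    also have "\<dots> \<le> (\<Sum>i\<in>J. \<Sum>j\<in>J. (if i = j then 1 else 0) + (1 - a i) ^ m * (1 - a j) ^ m)"
    proof (intro sum_mono)
      fix i j assume ij: "i \<in> J" "j \<in> J"
      show "walk_mean G Q m (\<lambda>x. h i x * h j x) \<le> (if i = j then 1 else 0) + (1 - a i) ^ m * (1 - a j) ^ m"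
      proof (cases "i = j")
        case True
        have "walk_mean G Q m (\<lambda>x. h i x * h j x) \<le> walk_mean G Q m (\<lambda>_. 1)"
          unfolding walk_mean_def h_def True power2_eq_square[symmetric]
          by (intro sum_mono mult_left_mono P_nonneg) (simp_all add: abs_square_le_1)
        moreover have "0 \<le> (1 - a i) ^ m * (1 - a j) ^ m" unfolding True by simp
        ultimately have "walk_mean G Q m (\<lambda>x. h i x * h j x) \<le> 1 + (1 - a i) ^ m * (1 - a j) ^ m"
          unfolding walk_mean_1 by linarith
        then show ?thesis using True by simp
      next
        case False
        have sub: "{i, j} \<subseteq> {1..n}" using ij J(1) by blast
        have "walk_mean G Q m (\<lambda>x. h i x * h j x) = (1 - a i - a j) ^ m"
          using walk_mean_prod_cos[OF sub, of m] False unfolding h_def a_def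
          by (simp add: algebra_simps)
        also have "\<dots> \<le> ((1 - a i) * (1 - a j)) ^ m"
          using pair_le[OF ij False] a_nonneg ij by (intro power_mono) (auto simp: algebra_simps)
        finally show ?thesis using False by (simp add: power_mult_distrib)
      qed
    qed
    also have "\<dots> = real (card J) + \<mu>\<^sup>2"
      unfolding \<mu>_eq power2_eq_square sum_product using finJ by (simp add: sum.distrib)
    finally show ?thesis .
  qed
  have variance: "(\<Sum>x\<in>carrier G. conv_power G Q m x * (f x - \<mu>)\<^sup>2) \<le> real (card J)"
  proof -
    have "(\<Sum>x\<in>carrier G. conv_power G Q m x * (f x - \<mu>)\<^sup>2) =
       (\<Sum>x\<in>carrier G. conv_power G Q m x * (f x)\<^sup>2 - 2 * \<mu> * (conv_power G Q m x * f x) + \<mu>\<^sup>2 * (conv_power G Q m x * 1))"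
      by (intro sum.cong refl) (simp add: power2_eq_square algebra_simps)
    also have "\<dots> = walk_mean G Q m (\<lambda>y. (f y)\<^sup>2) - 2 * \<mu> * \<mu> + \<mu>\<^sup>2 * walk_mean G Q m (\<lambda>_. 1)"
      unfolding sum.distrib sum_subtractf sum_distrib_left[symmetric] by (simp add: \<mu>_def walk_mean_def)
    also have "\<dots> \<le> real (card J)"
      using second_moment by (simp add: walk_mean_1 power2_eq_square)
    finally show ?thesis .
  qed
  have uniform: "(\<Sum>x\<in>carrier G. 1 / ?c * (f x)\<^sup>2) \<le> real (card J)"
  proof -
    have "(\<Sum>x\<in>carrier G. (f x)\<^sup>2) = (\<Sum>i\<in>J. \<Sum>j\<in>J. \<Sum>x\<in>carrier G. h i x * h j x)"
      unfolding f_def power2_eq_square sum_product by (subst sum.swap) (intro sum.cong refl sum.swap)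
    also have "\<dots> \<le> (\<Sum>i\<in>J. \<Sum>j\<in>J. if i = j then ?c else 0)"
    proof (intro sum_mono)
      fix i j assume ij: "i \<in> J" "j \<in> J"
      show "(\<Sum>x\<in>carrier G. h i x * h j x) \<le> (if i = j then ?c else 0)"
      proof (cases "i = j")
        case True
        have "(\<Sum>x\<in>carrier G. h i x * h j x) \<le> (\<Sum>x\<in>carrier G. 1)"
          unfolding h_def True power2_eq_square[symmetric]
          by (intro sum_mono) (simp add: abs_square_le_1)
        then show ?thesis using True by simp
      next
        case False
        have sub: "{i, j} \<subseteq> {1..n}" using ij J(1) by blast
        show ?thesis
          using uniform_sum_prod_cos[OF sub] False unfolding h_def by simp
      qed
    qed
    also have "\<dots> = real (card J) * ?c" using finJ by simp
    finally have "(\<Sum>x\<in>carrier G. (f x)\<^sup>2) \<le> real (card J) * ?c" .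
    then show ?thesis using c by (simp add: field_simps flip: sum_divide_distrib)
  qed
  define E where "E = {x \<in> carrier G. f x > \<mu> / 2}"
  have E: "E \<subseteq> carrier G" by (auto simp: E_def)
  have "(\<mu> / 2)\<^sup>2 * (\<Sum>x\<in>carrier G - E. conv_power G Q m x) \<le> (\<Sum>x\<in>carrier G. conv_power G Q m x * (f x - \<mu>)\<^sup>2)"
    using \<mu>_pos P_nonneg finite_G by (intro chebyshev_finite) (auto simp: E_def)
  with variance have 1: "(\<mu> / 2)\<^sup>2 * (\<Sum>x\<in>carrier G - E. conv_power G Q m x) \<le> real (card J)" by linarith
  have "(\<mu> / 2)\<^sup>2 * (\<Sum>x\<in>E. 1 / ?c) \<le> (\<Sum>x\<in>carrier G. 1 / ?c * (f x)\<^sup>2)"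
    using \<mu>_pos finite_G E by (intro chebyshev_finite) (auto simp: E_def)
  with uniform have 2: "(\<mu> / 2)\<^sup>2 * (real (card E) / ?c) \<le> real (card J)" by simp
  have "(\<Sum>x\<in>carrier G - E. conv_power G Q m x) = 1 - (\<Sum>x\<in>E. conv_power G Q m x)"
    using walk_mean_1[of m] finite_G E by (simp add: sum_diff walk_mean_def)
  with 1 2 have "(\<mu> / 2)\<^sup>2 * (1 - ((\<Sum>x\<in>E. conv_power G Q m x) - real (card E) / ?c)) \<le> 2 * real (card J)"
    by (simp add: algebra_simps)
  then have "1 - ((\<Sum>x\<in>E. conv_power G Q m x) - real (card E) / ?c) \<le> 8 * real (card J) / \<mu>\<^sup>2"
    using \<mu>_pos by (simp add: field_simps)
  also have "\<dots> \<le> 8 * real (card J) / (real (card J) * (1 - \<rho>) ^ m)\<^sup>2"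
    using \<mu>_ge cardJ \<rho>(2) \<mu>_pos by (intro divide_left_mono power_mono mult_pos_pos) auto
  also have "\<dots> = 8 / (real (card J) * (1 - \<rho>) ^ (2 * m))"
    using cardJ by (simp add: power2_eq_square power_add mult_2)
  finally have "1 - 8 / (real (card J) * (1 - \<rho>) ^ (2 * m)) \<le> (\<Sum>x\<in>E. conv_power G Q m x) - real (card E) / ?c"
    by linarith
  also have "\<dots> \<le> d_TV G Q m" by (rule d_TV_ge_event[OF finite_G E])
  finally show ?thesis .
qed

end

section \<open>Criteria for cutoff\<close>

text \<open>
  A power of \<open>1 - x\<close> is nearly as large as the exponential when \<open>x\<close> is small; this transfers the
  decay of a discrete-time mean to the exponential scale.
\<close>
lemma exp_le_one_minus:
  fixes x :: real
  assumes "0 \<le> x" "x \<le> 1 / 2"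
  shows "exp (- x * (1 + 2 * x)) \<le> 1 - x"
proof -
  have "- x * (1 + 2 * x) \<le> ln (1 - x)"
    using ln_one_minus_pos_lower_bound[OF assms] by (simp add: power2_eq_square algebra_simps)
  then have "exp (- x * (1 + 2 * x)) \<le> exp (ln (1 - x))" by (rule exp_le_cancel_iff[THEN iffD2])
  then show ?thesis using assms by simp
qed

text \<open>
  The family of product walks given by a sequence of weights: \<open>q n\<close> is the normalizing sum of the
  \<open>n\<close>th walk, and \<open>w i\<close> is the relaxation rate of coordinate \<open>i\<close> when time is measured in units of
  \<open>q n\<close>, the same in all walks that contain it.
\<close>
locale positive_weights =
  fixes p :: "nat \<Rightarrow> real"
  assumes p_pos: "\<And>i. i \<ge> 1 \<Longrightarrow> 0 < p i"
begin

definition q :: "nat \<Rightarrow> real" where "q n = (\<Sum>i=1..n. p i)"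

definition w :: "nat \<Rightarrow> real" where "w i = p i * gap i"

definition d :: "nat \<Rightarrow> nat \<Rightarrow> real"
  where "d n m = d_TV (family_group zmod_group n) (family_prob zmod_group zmod_prob p n) m"

definition T :: "nat \<Rightarrow> real \<Rightarrow> nat"
  where "T n \<epsilon> = T_TV (family_group zmod_group n) (family_prob zmod_group zmod_prob p n) \<epsilon>"

lemma w_pos: "i \<ge> 1 \<Longrightarrow> 0 < w i"
  unfolding w_def using p_pos gap_pos by simp

lemma w_le_p: "i \<ge> 1 \<Longrightarrow> w i \<le> p i"
  unfolding w_def using p_pos gap_le_1 by (simp add: mult_left_le less_imp_le)

lemma p_le_q: "1 \<le> i \<Longrightarrow> i \<le> n \<Longrightarrow> p i \<le> q n"
  unfolding q_def using p_pos by (intro member_le_sum) (auto intro: less_imp_le)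

lemma q_pos: "n \<ge> 1 \<Longrightarrow> 0 < q n"
  using p_le_q[of 1 n] p_pos[of 1] by simp

lemma torus:
  assumes "n \<ge> 1"
  shows "lazy_torus_walk n (\<lambda>i. p i / q n)"
    and "d n m = d_TV (lazy_torus_walk.G n) (lazy_torus_walk.Q n (\<lambda>i. p i / q n)) m"
proof -
  show 1: "lazy_torus_walk n (\<lambda>i. p i / q n)"
  proof
    show "(\<Sum>i=1..n. p i / q n) = 1"
      using q_pos[OF assms] by (simp add: q_def flip: sum_divide_distrib)
  qed (use assms p_pos q_pos[OF assms] in auto)
  show "d n m = d_TV (lazy_torus_walk.G n) (lazy_torus_walk.Q n (\<lambda>i. p i / q n)) m"
    unfolding d_def lazy_torus_walk.G_def[OF 1] lazy_torus_walk.Q_def[OF 1]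
    unfolding family_prob_def q_def ..
qed

lemma d_le:
  assumes n: "n \<ge> 1" and m: "m \<ge> 1" and \<epsilon>: "\<epsilon> > 0"
    and S: "(\<Sum>i=1..n. 2 / (exp (2 * real m / q n * w i) - 1)) \<le> ln (1 + 4 * \<epsilon>\<^sup>2)"
  shows "d n m \<le> \<epsilon>"
proof -
  let ?S = "\<Sum>i=1..n. 2 / (exp (2 * real m / q n * w i) - 1)"
  have "4 * (d n m)\<^sup>2 \<le> exp ?S - 1"
    using lazy_torus_walk.d_TV_upper[OF torus(1)[OF n] m]
    unfolding torus(2)[OF n] w_def by (simp add: mult_ac)
  also have "exp ?S \<le> 1 + 4 * \<epsilon>\<^sup>2"
  proof -
    have "0 < 1 + 4 * \<epsilon>\<^sup>2" by (simp add: add_pos_nonneg)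
    then show ?thesis using S by (metis exp_le_cancel_iff exp_ln)
  qed
  finally have "(d n m)\<^sup>2 \<le> \<epsilon>\<^sup>2" by simp
  then show ?thesis using \<epsilon> by (meson power2_le_imp_le less_imp_le)
qed

lemma d_ge_one_coordinate:
  assumes "1 \<le> i" "i \<le> n"
  shows "(1 - w i / q n) ^ m / 2 \<le> d n m"
  using lazy_torus_walk.d_TV_lower_one_coordinate[OF torus(1), of n i m] assms
  unfolding w_def by (simp add: torus(2)[symmetric])

lemma d_ge_many_coordinates:
  assumes "J \<subseteq> {1..n}" "J \<noteq> {}" "\<And>j. j \<in> J \<Longrightarrow> w j / q n \<le> \<rho>" "\<rho> < 1"
  shows "1 - 8 / (real (card J) * (1 - \<rho>) ^ (2 * m)) \<le> d n m"
proof -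
  have n: "n \<ge> 1" using assms(1,2) by force
  show ?thesis
    unfolding torus(2)[OF n]
    by (rule lazy_torus_walk.d_TV_lower_many_coordinates[OF torus(1)[OF n] assms(1,2) _ assms(4)])
       (use assms(3) in \<open>simp add: w_def\<close>)
qed

lemma T_le: "d n m \<le> \<epsilon> \<Longrightarrow> T n \<epsilon> \<le> m"
  unfolding T_def T_TV_def d_def by (rule Least_le)

text \<open>
  The distance tends to 0 for each fixed \<open>n\<close>, so that the least time in the definition of the mixing
  time exists.
\<close>
lemma d_T_le:
  assumes n: "n \<ge> 1" and \<epsilon>: "\<epsilon> > 0"
  shows "d n (T n \<epsilon>) \<le> \<epsilon>"
proof -
  have "(\<lambda>m. \<Sum>i=1..n. 2 / (exp (2 * real m / q n * w i) - 1)) \<longlonglongrightarrow> (\<Sum>i=1..n. 0)"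
  proof (rule tendsto_sum)
    fix i assume "i \<in> {1..n}"
    define c where "c = w i / q n"
    have "0 < c" using \<open>i \<in> {1..n}\<close> w_pos q_pos[OF n] by (simp add: c_def)
    then have "(\<lambda>m. 2 / (exp (2 * real m * c) - 1)) \<longlonglongrightarrow> 0" by real_asymp
    then show "(\<lambda>m. 2 / (exp (2 * real m / q n * w i) - 1)) \<longlonglongrightarrow> 0" by (simp add: c_def)
  qed
  moreover have "1 < 1 + 4 * \<epsilon>\<^sup>2" using \<epsilon> by simp
  then have "(\<Sum>i=1..n. 0) < ln (1 + 4 * \<epsilon>\<^sup>2)" by (simp only: sum.neutral_const ln_gt_zero)
  ultimately have "\<forall>\<^sub>F m in sequentially. (\<Sum>i=1..n. 2 / (exp (2 * real m / q n * w i) - 1)) < ln (1 + 4 * \<epsilon>\<^sup>2)"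
    by (rule order_tendstoD)
  then have "\<forall>\<^sub>F m in sequentially. d n m \<le> \<epsilon>"
    using eventually_ge_at_top[of 1]
  proof eventually_elim
    case (elim m)
    then show ?case by (intro d_le n \<epsilon>) auto
  qed
  then obtain m where "d n m \<le> \<epsilon>" unfolding eventually_sequentially by blast
  then show ?thesis
    unfolding T_def T_TV_def d_def by (rule LeastI)
qed

text \<open>
  At time \<open>t * q n\<close> the sum in the upper bound is dominated by a convergent series that does not
  depend on \<open>n\<close>, so the mixing time at level 1/2 is at most \<open>(t + 1) * q n\<close>. The first coordinate
  alone needs a time that is a multiple of \<open>q n\<close>, with a factor that can be made twice as large by
  choosing \<open>\<epsilon>\<close> small.
\<close>
theorem no_cutoff_if_rates_grow:
  assumes c: "c > 0" and growth: "\<And>i. i \<ge> 1 \<Longrightarrow> c * ln (real i + 1) \<le> w i"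
  shows "TV_mixing_diverges (family_group zmod_group) (family_prob zmod_group zmod_prob p)"
    and "\<not> TV_cutoff (family_group zmod_group) (family_prob zmod_group zmod_prob p)"
proof -
  \<comment> \<open>With this \<open>t\<close>, the exponent of coordinate \<open>i\<close> is at least \<open>5 * ln (i + 1)\<close>. Three of the five
      powers of \<open>i + 1\<close> give the factor 8 that brings the sum below \<open>1 / 2 < ln 2\<close>, and the other two
      make it telescope.\<close>
  define t where "t = 5 / (2 * c)"
  have t: "t > 0" using c by (simp add: t_def)
  \<comment> \<open>This level is so small that the first coordinate needs the time \<open>2 * (t + 1) * q n\<close>.\<close>
  define \<epsilon> where "\<epsilon> = exp (- (4 * w 1 * (t + 1))) / 2"
  have w1: "w 1 > 0" using w_pos[of 1] by simp
  have "exp (- (4 * w 1 * (t + 1))) < 1" using w1 t by simp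
  then have \<epsilon>: "0 < \<epsilon>" "\<epsilon> < 1" unfolding \<epsilon>_def by (simp, linarith)
  have "filterlim (\<lambda>n. c * ln (real n + 1)) at_top sequentially" using c by real_asymp
  then have q_lim: "filterlim q at_top sequentially"
  proof (rule filterlim_at_top_mono)
    show "\<forall>\<^sub>F n in sequentially. c * ln (real n + 1) \<le> q n"
      using eventually_ge_at_top[of 1]
    proof eventually_elim
      case (elim n)
      then show ?case using growth[of n] w_le_p[of n] p_le_q[of n n] by linarith
    qed
  qed
  have upper: "real (T n (1 / 2)) \<le> (t + 1) * q n" if n: "n \<ge> 1" and q1: "q n \<ge> 1" for n
  proof -
    define m where "m = nat \<lceil>t * q n\<rceil>"
    have "t * q n > 0" using t q1 by simp
    then have m: "real m \<ge> t * q n" "real m \<le> t * q n + 1" "m \<ge> 1"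
      unfolding m_def by linarith+
    have "(\<Sum>i=1..n. 2 / (exp (2 * real m / q n * w i) - 1)) \<le> (\<Sum>i=1..n. 1 / 2 * (1 / real i - 1 / real (Suc i)))"
    proof (rule sum_mono)
      fix i assume "i \<in> {1..n}"
      then have i: "i \<ge> 1" by simp
      have "5 * ln (real i + 1) = 2 * t * (c * ln (real i + 1))" using c by (simp add: t_def)
      also have "\<dots> \<le> (2 * real m / q n) * w i"
        using growth[OF i] t c m(1) q1 by (intro mult_mono) (auto simp: field_simps)
      finally have "exp (5 * ln (real i + 1)) \<le> exp (2 * real m / q n * w i)" by simp
      then have e: "(real i + 1) ^ 5 \<le> exp (2 * real m / q n * w i)"
        by (simp add: exp_of_nat_mult[of 5, simplified])
      have "(2::real) ^ 3 \<le> (real i + 1) ^ 3" using i by (intro power_mono) auto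
      then have "8 * (real i + 1) ^ 2 \<le> (real i + 1) ^ 3 * (real i + 1) ^ 2"
        by (intro mult_right_mono) auto
      also have "\<dots> = (real i + 1) ^ 5" by (simp flip: power_add)
      finally have "8 * (real i + 1) ^ 2 \<le> exp (2 * real m / q n * w i)" using e by linarith
      moreover have "(real i + 1) ^ 2 = real i * (real i + 1) + (real i + 1)" by (simp add: power2_eq_square algebra_simps)
      moreover have "1 \<le> real i * (real i + 1)" using i by (simp add: mult_ge1_I)
      ultimately have big: "4 * (real i * (real i + 1)) \<le> exp (2 * real m / q n * w i) - 1" by linarith
      have pos: "0 < 4 * (real i * (real i + 1))" using i by simp
      have "2 / (exp (2 * real m / q n * w i) - 1) \<le> 2 / (4 * (real i * (real i + 1)))"
        using big pos by (intro divide_left_mono mult_pos_pos[of "exp _ - 1"]) linarith+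
      also have "\<dots> = 1 / 2 * (1 / real i - 1 / real (Suc i))"
      proof -
        have "1 / real i - 1 / real (Suc i) = 1 / (real i * (real i + 1))" using i by (simp add: field_simps)
        then show ?thesis by simp
      qed
      finally show "2 / (exp (2 * real m / q n * w i) - 1) \<le> 1 / 2 * (1 / real i - 1 / real (Suc i))" .
    qed
    also have "\<dots> = 1 / 2 * (1 - 1 / real (Suc n))"
    proof -
      have "(\<Sum>i=1..n. 1 / real i - 1 / real (Suc i)) = 1 - 1 / real (Suc n)" by (induction n) auto
      then show ?thesis by (simp only: sum_distrib_left[symmetric])
    qed
    also have "\<dots> \<le> 1 / 2" by simp
    also have "\<dots> \<le> ln (1 + 4 * (1 / 2)\<^sup>2)"
      using ln2_ge_two_thirds by (simp add: power2_eq_square)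
    finally have "d n m \<le> 1 / 2" using n m(3) by (intro d_le) auto
    then have "real (T n (1 / 2)) \<le> real m" using T_le by simp
    also have "\<dots> \<le> (t + 1) * q n" using m(2) q1 by (simp add: algebra_simps)
    finally show ?thesis .
  qed
  have lower: "2 * (t + 1) * q n \<le> real (T n \<epsilon>)" if n: "n \<ge> 1" and q2: "q n \<ge> 2 * w 1" for n
  proof -
    define x where "x = w 1 / q n"
    have x: "0 < x" "x \<le> 1 / 2" using w1 q2 by (auto simp: x_def field_simps)
    have "exp (- (2 * x * real (T n \<epsilon>))) = exp (- (2 * x)) ^ T n \<epsilon>"
      by (simp add: exp_of_nat_mult[symmetric] mult_ac)
    also have "\<dots> \<le> (1 - x) ^ T n \<epsilon>"
    proof (rule power_mono)
      have "x * (1 + 2 * x) \<le> x * 2" using x by (intro mult_left_mono) auto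
      then have "exp (- (2 * x)) \<le> exp (- x * (1 + 2 * x))" by (subst exp_le_cancel_iff) linarith
      also have "\<dots> \<le> 1 - x" using x by (intro exp_le_one_minus) auto
      finally show "exp (- (2 * x)) \<le> 1 - x" .
    qed simp
    also have "\<dots> \<le> 2 * \<epsilon>"
      using d_ge_one_coordinate[of 1 n "T n \<epsilon>"] d_T_le[OF n \<epsilon>(1)] n by (simp add: x_def)
    also have "\<dots> = exp (- (4 * w 1 * (t + 1)))" by (simp add: \<epsilon>_def)
    finally have "4 * w 1 * (t + 1) \<le> 2 * x * real (T n \<epsilon>)" by simp
    then have "w 1 * (2 * (t + 1) * q n) \<le> w 1 * real (T n \<epsilon>)"
      using q_pos[OF n] by (simp add: x_def field_simps)
    then show ?thesis using w1 by (simp only: mult_le_cancel_left_pos)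
  qed
  have ev: "\<forall>\<^sub>F n in sequentially. n \<ge> 1 \<and> q n \<ge> 1 \<and> q n \<ge> 2 * w 1"
    using q_lim eventually_ge_at_top[of 1]
    unfolding filterlim_at_top by (intro eventually_conj) auto
  show "TV_mixing_diverges (family_group zmod_group) (family_prob zmod_group zmod_prob p)"
    unfolding TV_mixing_diverges_def T_def[symmetric]
  proof (intro bexI[of _ \<epsilon>])
    have "filterlim (\<lambda>n. real (T n \<epsilon>)) at_top sequentially"
    proof (rule filterlim_at_top_mono[OF q_lim])
      show "\<forall>\<^sub>F n in sequentially. q n \<le> real (T n \<epsilon>)"
        using ev
      proof eventually_elim
        case (elim n)
        then have "1 * q n \<le> 2 * (t + 1) * q n" using t by (intro mult_right_mono) auto
        then show ?case using lower[of n] elim by linarith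
      qed
    qed
    then show "filterlim (\<lambda>n. T n \<epsilon>) at_top sequentially"
      by (simp add: filterlim_sequentially_iff_filterlim_real)
  qed (use \<epsilon> in auto)
  show "\<not> TV_cutoff (family_group zmod_group) (family_prob zmod_group zmod_prob p)"
  proof
    assume "TV_cutoff (family_group zmod_group) (family_prob zmod_group zmod_prob p)"
    then have "(\<lambda>n. real (T n (1 / 2)) / real (T n \<epsilon>)) \<longlonglongrightarrow> 1"
      unfolding TV_cutoff_def T_def[symmetric] using \<epsilon> by auto
    moreover have "\<forall>\<^sub>F n in sequentially. real (T n (1 / 2)) / real (T n \<epsilon>) \<le> 1 / 2"
      using ev
    proof eventually_elim
      case (elim n)
      have "0 < (t + 1) * q n" using t elim by simp
      moreover have "real (T n (1 / 2)) \<le> (t + 1) * q n" using upper elim by blast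
      moreover have "2 * ((t + 1) * q n) \<le> real (T n \<epsilon>)" using lower elim by (simp only: mult.assoc)
      ultimately have "0 < real (T n \<epsilon>)" "2 * real (T n (1 / 2)) \<le> real (T n \<epsilon>)" by linarith+
      then show ?case by (simp add: divide_le_eq)
    qed
    ultimately have "1 \<le> (1 / 2 :: real)"
      by (intro tendsto_upperbound[of _ "1 :: real" sequentially]) auto
    then show False by simp
  qed
qed

text \<open>
  The finitely many coordinates before the growth sets in only lower the constant, since each rate is
  positive.
\<close>
theorem no_cutoff_if_rates_outgrow_log:
  assumes "filterlim (\<lambda>i. w i / ln (real i + 1)) at_top sequentially"
  shows "TV_mixing_diverges (family_group zmod_group) (family_prob zmod_group zmod_prob p)"
    and "\<not> TV_cutoff (family_group zmod_group) (family_prob zmod_group zmod_prob p)"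
proof -
  have "\<forall>\<^sub>F i in sequentially. 1 \<le> w i / ln (real i + 1)"
    using assms by (simp add: filterlim_at_top)
  then obtain i0 where i0: "\<And>i. i \<ge> i0 \<Longrightarrow> 1 \<le> w i / ln (real i + 1)"
    unfolding eventually_sequentially by blast
  define c where "c = min 1 (Min ((\<lambda>i. w i / ln (real i + 1)) ` {1..Suc i0}))"
  have ln_pos: "0 < ln (real i + 1)" if "i \<ge> 1" for i using that by simp
  have c: "c > 0"
    unfolding c_def using w_pos ln_pos by (auto simp: Min_gr_iff)
  have growth: "c * ln (real i + 1) \<le> w i" if i: "i \<ge> 1" for i
  proof -
    have "c \<le> w i / ln (real i + 1)"
    proof (cases "i \<le> i0")
      case True
      then have "Min ((\<lambda>i. w i / ln (real i + 1)) ` {1..Suc i0}) \<le> w i / ln (real i + 1)"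
        using i by (intro Min_le) auto
      then show ?thesis by (simp add: c_def)
    next
      case False
      then have "1 \<le> w i / ln (real i + 1)" by (intro i0) simp
      moreover have "c \<le> 1" by (simp add: c_def)
      ultimately show ?thesis by linarith
    qed
    then show ?thesis using ln_pos[OF i] by (simp only: pos_le_divide_eq)
  qed
  show "TV_mixing_diverges (family_group zmod_group) (family_prob zmod_group zmod_prob p)"
    using c growth by (rule no_cutoff_if_rates_grow(1))
  show "\<not> TV_cutoff (family_group zmod_group) (family_prob zmod_group zmod_prob p)"
    using c growth by (rule no_cutoff_if_rates_grow(2))
qed

text \<open>
  The bounds on the distance hold for all times on one side of the window, which spares the
  monotonicity of the distance in time. Rounding the upper end to an integer costs at most 1, which
  is less than \<open>\<eta> / 2 * t n\<close> in the limit.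
\<close>
theorem cutoff_if_window:
  assumes t: "filterlim t at_top sequentially"
    and upper: "\<And>\<eta> \<epsilon>. \<eta> > 0 \<Longrightarrow> \<epsilon> > 0 \<Longrightarrow>
      \<forall>\<^sub>F n in sequentially. \<forall>m. (1 + \<eta>) * t n \<le> real m \<longrightarrow> d n m \<le> \<epsilon>"
    and lower: "\<And>\<eta> \<epsilon>. \<eta> > 0 \<Longrightarrow> \<eta> < 1 \<Longrightarrow> \<epsilon> < 1 \<Longrightarrow>
      \<forall>\<^sub>F n in sequentially. \<forall>m. real m \<le> (1 - \<eta>) * t n \<longrightarrow> \<epsilon> < d n m"
  shows "TV_mixing_diverges (family_group zmod_group) (family_prob zmod_group zmod_prob p)"
    and "TV_cutoff (family_group zmod_group) (family_prob zmod_group zmod_prob p)"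
proof -
  have T_lower: "\<forall>\<^sub>F n in sequentially. (1 - \<eta>) * t n < real (T n \<epsilon>)"
    if "\<eta> > 0" "\<eta> < 1" "0 < \<epsilon>" "\<epsilon> < 1" for \<eta> \<epsilon>
    using lower[OF that(1,2,4)] eventually_ge_at_top[of 1]
  proof eventually_elim
    case (elim n)
    then show ?case using d_T_le[OF elim(2) that(3)] by (meson linorder_not_le)
  qed
  have T_upper: "\<forall>\<^sub>F n in sequentially. real (T n \<epsilon>) \<le> (1 + \<eta>) * t n"
    if "\<eta> > 0" "0 < \<epsilon>" for \<eta> \<epsilon>
  proof -
    have "\<forall>\<^sub>F n in sequentially. 2 / \<eta> \<le> t n" using t by (simp add: filterlim_at_top)
    moreover have "\<forall>\<^sub>F n in sequentially. 0 \<le> t n" using t by (simp add: filterlim_at_top)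
    moreover have "\<forall>\<^sub>F n in sequentially. \<forall>m. (1 + \<eta> / 2) * t n \<le> real m \<longrightarrow> d n m \<le> \<epsilon>"
      using that by (intro upper) auto
    ultimately show ?thesis
    proof eventually_elim
      case (elim n)
      define m where "m = nat \<lceil>(1 + \<eta> / 2) * t n\<rceil>"
      have "0 \<le> (1 + \<eta> / 2) * t n" using elim that by simp
      then have m: "(1 + \<eta> / 2) * t n \<le> real m" "real m \<le> (1 + \<eta> / 2) * t n + 1"
        unfolding m_def by linarith+
      have "real (T n \<epsilon>) \<le> real m" using T_le elim m(1) by simp
      also have "\<dots> \<le> (1 + \<eta>) * t n"
        using m(2) elim(1) that by (simp add: field_simps)
      finally show ?case .
    qed
  qed
  have T_asymp: "(\<lambda>n. real (T n \<epsilon>) / t n) \<longlonglongrightarrow> 1" if "0 < \<epsilon>" "\<epsilon> < 1" for \<epsilon>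
  proof (rule tendstoI)
    fix e :: real assume "e > 0"
    define \<eta> where "\<eta> = min (e / 2) (1 / 2)"
    have \<eta>: "\<eta> > 0" "\<eta> < 1" "\<eta> < e" using \<open>e > 0\<close> by (auto simp: \<eta>_def)
    have "\<forall>\<^sub>F n in sequentially. t n > 0" using t by (simp add: filterlim_at_top_dense)
    with T_lower[OF \<eta>(1,2) that] T_upper[OF \<eta>(1) that(1)]
    show "\<forall>\<^sub>F n in sequentially. dist (real (T n \<epsilon>) / t n) 1 < e"
    proof eventually_elim
      case (elim n)
      have "1 - \<eta> < real (T n \<epsilon>) / t n" using elim by (simp add: less_divide_eq)
      moreover have "real (T n \<epsilon>) / t n \<le> 1 + \<eta>" using elim by (simp add: divide_le_eq)
      ultimately show ?case using \<eta>(3) unfolding dist_real_def by linarith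
    qed
  qed
  show "TV_mixing_diverges (family_group zmod_group) (family_prob zmod_group zmod_prob p)"
    unfolding TV_mixing_diverges_def T_def[symmetric]
  proof (intro bexI[of _ "1 / 2"])
    have "filterlim (\<lambda>n. (1 - 1 / 2) * t n) at_top sequentially"
      by (rule filterlim_tendsto_pos_mult_at_top[OF tendsto_const _ t]) simp
    then have "filterlim (\<lambda>n. real (T n (1 / 2))) at_top sequentially"
    proof (rule filterlim_at_top_mono)
      show "\<forall>\<^sub>F n in sequentially. (1 - 1 / 2) * t n \<le> real (T n (1 / 2))"
        using T_lower[of "1 / 2" "1 / 2"] by (auto elim: eventually_mono)
    qed
    then show "filterlim (\<lambda>n. T n (1 / 2)) at_top sequentially"
      by (simp add: filterlim_sequentially_iff_filterlim_real)
  qed simp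
  show "TV_cutoff (family_group zmod_group) (family_prob zmod_group zmod_prob p)"
    unfolding TV_cutoff_def T_def[symmetric]
  proof (intro ballI)
    fix \<epsilon> \<delta> :: real assume "\<epsilon> \<in> {0<..<1}" "\<delta> \<in> {0<..<1}"
    then have "(\<lambda>n. (real (T n \<epsilon>) / t n) / (real (T n \<delta>) / t n)) \<longlonglongrightarrow> 1 / 1"
      by (intro tendsto_divide T_asymp) auto
    moreover have "\<forall>\<^sub>F n in sequentially. t n > 0" using t by (simp add: filterlim_at_top_dense)
    then have "\<forall>\<^sub>F n in sequentially. (real (T n \<epsilon>) / t n) / (real (T n \<delta>) / t n) = real (T n \<epsilon>) / real (T n \<delta>)"
      by eventually_elim simp
    ultimately show "(\<lambda>n. real (T n \<epsilon>) / real (T n \<delta>)) \<longlonglongrightarrow> 1"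
      unfolding div_by_1 by (rule Lim_transform_eventually)
  qed
qed

text \<open>
  With \<open>\<beta> = 2 - \<gamma>\<close> and \<open>\<kappa> = c * \<pi>\<^sup>2\<close> the rates are asymptotic to \<open>\<kappa> / i powr \<beta>\<close>. At the time
  \<open>(1 + \<eta>) * t n\<close> each but finitely many of the \<open>n\<close> terms in the upper bound is at most about
  \<open>2 / n powr (1 + \<eta> / 2)\<close>, so that their sum vanishes. At the time \<open>(1 - \<eta>) * t n\<close> the coordinates
  between \<open>(1 - \<delta>) * n\<close> and \<open>n\<close>, about \<open>\<delta> * n\<close> in number, have means of at least
  \<open>n powr (\<eta> / 8 - 1 / 2)\<close>, which is large compared with \<open>1 / sqrt (\<delta> * n)\<close>.
\<close>
theorem cutoff_if_power_law:
  assumes \<gamma>: "0 < \<gamma>" "\<gamma> \<le> 2" and c: "c > 0"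
    and p_asymp: "(\<lambda>i. p i / real i powr \<gamma>) \<longlonglongrightarrow> c"
  shows "TV_mixing_diverges (family_group zmod_group) (family_prob zmod_group zmod_prob p)"
    and "TV_cutoff (family_group zmod_group) (family_prob zmod_group zmod_prob p)"
proof -
  define \<beta> where "\<beta> = 2 - \<gamma>"
  have \<beta>: "0 \<le> \<beta>" "\<beta> < 2" using \<gamma> by (auto simp: \<beta>_def)
  define \<kappa> where "\<kappa> = c * pi\<^sup>2"
  have \<kappa>: "\<kappa> > 0" using c by (simp add: \<kappa>_def)
  have w_asymp: "(\<lambda>i. w i * real i powr \<beta>) \<longlonglongrightarrow> \<kappa>"
  proof -
    have "(\<lambda>i. (p i / real i powr \<gamma>) * ((real i)\<^sup>2 * gap i)) \<longlonglongrightarrow> \<kappa>"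
      unfolding \<kappa>_def by (intro tendsto_mult p_asymp gap_asymp)
    moreover have "\<forall>\<^sub>F i in sequentially. (p i / real i powr \<gamma>) * ((real i)\<^sup>2 * gap i) = w i * real i powr \<beta>"
      using eventually_ge_at_top[of 1]
    proof eventually_elim
      case (elim i)
      then have "(real i)\<^sup>2 = real i powr \<gamma> * real i powr \<beta>"
        by (simp add: \<beta>_def flip: powr_add)
      with elim show ?case by (simp add: w_def field_simps)
    qed
    ultimately show ?thesis by (rule Lim_transform_eventually)
  qed
  define u where "u n = q n * real n powr \<beta>" for n
  have u_lim: "filterlim (\<lambda>n. u n) at_top sequentially"
  proof (rule filterlim_at_top_mono)
    show "filterlim (\<lambda>n. c / 2 * (real n)\<^sup>2) at_top sequentially" using c by real_asymp
    have "\<forall>\<^sub>F n in sequentially. c / 2 < p n / real n powr \<gamma>"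
      using p_asymp c by (intro order_tendstoD(1)) auto
    then show "\<forall>\<^sub>F n in sequentially. c / 2 * (real n)\<^sup>2 \<le> u n"
      using eventually_ge_at_top[of 1]
    proof eventually_elim
      case (elim n)
      have "(real n)\<^sup>2 = real n powr \<gamma> * real n powr \<beta>"
        using elim by (simp add: \<beta>_def flip: powr_add)
      then have "c / 2 * (real n)\<^sup>2 = (c / 2 * real n powr \<gamma>) * real n powr \<beta>" by simp
      also have "\<dots> \<le> q n * real n powr \<beta>"
        using elim p_le_q[of n n] by (intro mult_right_mono) (auto simp: less_divide_eq)
      finally show ?case by (simp add: u_def)
    qed
  qed
  define t where "t n = u n * ln (real n) / (2 * \<kappa>)" for n
  have t_lim: "filterlim t at_top sequentially"
  proof -
    have "filterlim (\<lambda>n. ln (real n) / (2 * \<kappa>)) at_top sequentially" using \<kappa> by real_asymp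
    from filterlim_at_top_mult_at_top[OF u_lim this] show ?thesis by (simp add: t_def[abs_def])
  qed
  have upper: "\<forall>\<^sub>F n in sequentially. \<forall>m. (1 + \<eta>) * t n \<le> real m \<longrightarrow> d n m \<le> \<epsilon>"
    if \<eta>: "\<eta> > 0" and \<epsilon>: "\<epsilon> > 0" for \<eta> \<epsilon> :: real
  proof -
    have "\<kappa> * (1 + \<eta> / 2) / (1 + \<eta>) < \<kappa>" using \<eta> \<kappa> by (simp add: field_simps)
    then have "\<forall>\<^sub>F i in sequentially. \<kappa> * (1 + \<eta> / 2) / (1 + \<eta>) < w i * real i powr \<beta>"
      using w_asymp by (intro order_tendstoD(1))
    then obtain i0 where i0: "\<And>i. i \<ge> i0 \<Longrightarrow> \<kappa> * (1 + \<eta> / 2) / (1 + \<eta>) < w i * real i powr \<beta>"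
      unfolding eventually_sequentially by blast
    \<comment> \<open>The coordinates up to \<open>i0\<close> may have smaller rates, in particular if \<open>\<beta> = 0\<close>; there are
        boundedly many of them, and any fixed positive rate makes their terms vanish.\<close>
    define w0 where "w0 = Min (w ` {1..Suc i0})"
    have w0: "w0 > 0" unfolding w0_def by (subst Min_gr_iff) (auto intro: w_pos)
    have w0_le: "w0 \<le> w i" if "i \<in> {1..i0}" for i
      unfolding w0_def using that by (intro Min_le) auto
    define a where "a = (1 + \<eta>) * w0 / \<kappa>"
    have a: "a > 0" using \<eta> w0 \<kappa> by (simp add: a_def)
    define F where "F n = real i0 * (2 / (real n powr a - 1)) + real n * (2 / (real n powr (1 + \<eta> / 2) - 1))" for n
    have "F \<longlonglongrightarrow> real i0 * 0 + 0"
      unfolding F_def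
    proof (intro tendsto_add tendsto_mult tendsto_const)
      show "(\<lambda>n. 2 / (real n powr a - 1)) \<longlonglongrightarrow> 0" using a by real_asymp
      show "(\<lambda>n. real n * (2 / (real n powr (1 + \<eta> / 2) - 1))) \<longlonglongrightarrow> 0" using \<eta> by real_asymp
    qed
    then have "F \<longlonglongrightarrow> 0" by simp
    moreover have "0 < ln (1 + 4 * \<epsilon>\<^sup>2)"
    proof -
      have "1 < 1 + 4 * \<epsilon>\<^sup>2" using \<epsilon> by simp
      then show ?thesis by (rule ln_gt_zero)
    qed
    ultimately have "\<forall>\<^sub>F n in sequentially. F n < ln (1 + 4 * \<epsilon>\<^sup>2)" by (rule order_tendstoD)
    moreover have "\<forall>\<^sub>F n in sequentially. 1 \<le> t n" using t_lim by (simp add: filterlim_at_top)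
    ultimately show ?thesis using eventually_ge_at_top[of 2]
    proof eventually_elim
      case (elim n)
      have n: "n \<ge> 1" "real n > 1" "ln (real n) > 0" using elim(3) by auto
      have q: "q n > 0" by (rule q_pos[OF n(1)])
      show ?case
      proof (intro allI impI)
        fix m assume m: "(1 + \<eta>) * t n \<le> real m"
        have "1 * 1 \<le> (1 + \<eta>) * t n" using \<eta> elim(2) by (intro mult_mono) auto
        then have m1: "m \<ge> 1" using m by linarith
        have m2: "(1 + \<eta>) * (real n powr \<beta> * ln (real n)) / \<kappa> \<le> 2 * real m / q n"
        proof -
          have "(1 + \<eta>) * (real n powr \<beta> * ln (real n)) / \<kappa> = 2 * ((1 + \<eta>) * t n) / q n"
            using q \<kappa> by (simp add: t_def u_def field_simps)
          also have "\<dots> \<le> 2 * real m / q n" using m q by (intro divide_right_mono) auto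
          finally show ?thesis .
        qed
        have big: "real n powr (1 + \<eta> / 2) \<le> exp (2 * real m / q n * w i)" if i: "i \<in> {1..n}" "i \<ge> i0" for i
        proof -
          have "(1 + \<eta> / 2) * ln (real n) = (1 + \<eta>) * ln (real n) / \<kappa> * (\<kappa> * (1 + \<eta> / 2) / (1 + \<eta>))"
          proof -
            have "h * L / k * (k * x / h) = x * L" if "h > 0" "k > 0" for h k x L :: real
              using that by simp
            from this[of "1 + \<eta>" \<kappa>] show ?thesis using \<eta> \<kappa> by simp
          qed
          also have "\<dots> \<le> (1 + \<eta>) * ln (real n) / \<kappa> * (w i * real n powr \<beta>)"
          proof (rule mult_left_mono)
            have "w i * real i powr \<beta> \<le> w i * real n powr \<beta>"
              using i \<beta> w_pos[of i] by (intro mult_left_mono powr_mono2) auto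
            then show "\<kappa> * (1 + \<eta> / 2) / (1 + \<eta>) \<le> w i * real n powr \<beta>"
              using i0[OF i(2)] by linarith
          qed (use \<eta> \<kappa> n in auto)
          also have "\<dots> = (1 + \<eta>) * (real n powr \<beta> * ln (real n)) / \<kappa> * w i" by simp
          also have "\<dots> \<le> 2 * real m / q n * w i"
            using m2 w_pos[of i] i by (intro mult_right_mono) auto
          finally show ?thesis using n by (simp add: powr_def)
        qed
        have small: "real n powr a \<le> exp (2 * real m / q n * w i)" if i: "i \<in> {1..i0}" for i
        proof -
          have "real n powr 0 \<le> real n powr \<beta>" using n \<beta> by (intro powr_mono) auto
          then have \<beta>1: "1 \<le> real n powr \<beta>" using n by simp
          have "a * ln (real n) = (1 + \<eta>) * (1 * ln (real n)) / \<kappa> * w0" by (simp add: a_def)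
          also have "\<dots> \<le> (1 + \<eta>) * (real n powr \<beta> * ln (real n)) / \<kappa> * w i"
            using \<eta> \<kappa> n w0 w0_le[OF i] \<beta>1
            by (intro mult_mono divide_right_mono) auto
          also have "\<dots> \<le> 2 * real m / q n * w i"
            using m2 w_pos[of i] i by (intro mult_right_mono) auto
          finally show ?thesis using n by (simp add: powr_def)
        qed
        have gt1: "1 < real n powr a" "1 < real n powr (1 + \<eta> / 2)"
          using n a \<eta> by (auto intro: gr_one_powr)
        let ?A = "2 / (real n powr a - 1)" and ?B = "2 / (real n powr (1 + \<eta> / 2) - 1)"
        have "(\<Sum>i=1..n. 2 / (exp (2 * real m / q n * w i) - 1)) \<le> (\<Sum>i=1..n. (if i \<in> {1..i0} then ?A else 0) + ?B)"
        proof (rule sum_mono)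
          fix i assume i: "i \<in> {1..n}"
          show "2 / (exp (2 * real m / q n * w i) - 1) \<le> (if i \<in> {1..i0} then ?A else 0) + ?B"
          proof (cases "i \<in> {1..i0}")
            case True
            have "2 / (exp (2 * real m / q n * w i) - 1) \<le> ?A"
              using small[OF True] gt1 by (intro divide_left_mono mult_pos_pos) linarith+
            moreover have "0 \<le> ?B" using gt1 by simp
            ultimately show ?thesis unfolding if_P[OF True] by linarith
          next
            case False
            then have "i \<ge> i0" using i by auto
            from big[OF i this] have "2 / (exp (2 * real m / q n * w i) - 1) \<le> ?B"
              using gt1 by (intro divide_left_mono mult_pos_pos) linarith+
            then show ?thesis unfolding if_not_P[OF False] by linarith
          qed
        qed
        also have "\<dots> = (\<Sum>i\<in>{1..n} \<inter> {1..i0}. ?A) + real n * ?B"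
          unfolding sum.distrib by (subst sum.inter_restrict) simp_all
        also have "\<dots> \<le> real i0 * ?A + real n * ?B"
        proof -
          have "card ({1..n} \<inter> {1..i0}) \<le> card {1..i0}" by (intro card_mono) auto
          then have "real (card ({1..n} \<inter> {1..i0})) * ?A \<le> real i0 * ?A"
            using gt1 by (intro mult_right_mono) auto
          then show ?thesis by simp
        qed
        also have "\<dots> = F n" by (simp add: F_def)
        also have "\<dots> \<le> ln (1 + 4 * \<epsilon>\<^sup>2)" using elim(1) by simp
        finally show "d n m \<le> \<epsilon>" by (intro d_le n(1) m1 \<epsilon>)
      qed
    qed
  qed
  have lower: "\<forall>\<^sub>F n in sequentially. \<forall>m. real m \<le> (1 - \<eta>) * t n \<longrightarrow> \<epsilon> < d n m"
    if \<eta>: "\<eta> > 0" "\<eta> < 1" and \<epsilon>: "\<epsilon> < 1" for \<eta> \<epsilon> :: real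
  proof -
    \<comment> \<open>The width \<open>\<delta>\<close> of the window is chosen such that no rate in it exceeds the asymptotic
        rate of coordinate \<open>n\<close> by so much that the margin \<open>\<eta>\<close> is used up; the square accounts
        for \<open>(1 - \<delta>) powr \<beta>\<close>, as \<open>\<beta> \<le> 2\<close>.\<close>
    have "((\<lambda>\<delta>. (1 - \<eta>) * (1 + \<delta>) / (1 - \<delta>)\<^sup>2) \<longlongrightarrow> (1 - \<eta>) * (1 + 0) / (1 - 0)\<^sup>2) (at_right 0)"
      by (intro tendsto_intros) auto
    moreover have "(1 - \<eta>) * (1 + 0) / (1 - 0)\<^sup>2 < 1 - \<eta> / 2" using \<eta> by simp
    ultimately have "\<forall>\<^sub>F \<delta> in at_right 0. (1 - \<eta>) * (1 + \<delta>) / (1 - \<delta>)\<^sup>2 < 1 - \<eta> / 2"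
      by (rule order_tendstoD(2))
    moreover have "\<forall>\<^sub>F \<delta> in at_right (0::real). \<delta> \<in> {0<..<1/2}"
      by (rule eventually_at_right_real) simp
    ultimately have "\<forall>\<^sub>F \<delta> in at_right 0. (1 - \<eta>) * (1 + \<delta>) / (1 - \<delta>)\<^sup>2 < 1 - \<eta> / 2 \<and> \<delta> \<in> {0<..<1/2}"
      by (rule eventually_conj)
    then obtain \<delta> where \<delta>: "(1 - \<eta>) * (1 + \<delta>) / (1 - \<delta>)\<^sup>2 < 1 - \<eta> / 2" "0 < \<delta>" "\<delta> < 1 / 2"
      using eventually_happens'[OF trivial_limit_at_right_real] by fastforce
    define \<kappa>' where "\<kappa>' = \<kappa> * (1 + \<delta>) / (1 - \<delta>)\<^sup>2"
    define \<rho> where "\<rho> n = \<kappa>' / u n" for n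
    have \<kappa>': "\<kappa>' > 0" using \<kappa> \<delta> by (simp add: \<kappa>'_def)
    have \<rho>_lim: "\<rho> \<longlonglongrightarrow> 0"
      unfolding \<rho>_def by (rule real_tendsto_divide_at_top[OF tendsto_const u_lim])
    have "\<forall>\<^sub>F i in sequentially. w i * real i powr \<beta> < \<kappa> * (1 + \<delta>)"
      using w_asymp \<kappa> \<delta> by (intro order_tendstoD(2)) auto
    then obtain i0 where i0: "\<And>i. i \<ge> i0 \<Longrightarrow> w i * real i powr \<beta> < \<kappa> * (1 + \<delta>)"
      unfolding eventually_sequentially by blast
    have "filterlim (\<lambda>n. \<delta> * real n powr (\<eta> / 4)) at_top sequentially" using \<delta> \<eta> by real_asymp
    then have "\<forall>\<^sub>F n in sequentially. 8 / (1 - \<epsilon>) < \<delta> * real n powr (\<eta> / 4)"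
      by (simp add: filterlim_at_top_dense)
    moreover have "\<forall>\<^sub>F n in sequentially. \<rho> n < \<eta> / 8" using \<rho>_lim \<eta> by (intro order_tendstoD(2)) auto
    moreover have "\<forall>\<^sub>F n in sequentially. n \<ge> max 2 (2 * i0)" by (rule eventually_ge_at_top)
    ultimately show ?thesis
    proof eventually_elim
      case (elim n)
      have n: "n \<ge> 1" "real n > 1" "ln (real n) > 0" "2 * i0 \<le> n" using elim(3) by auto
      have q: "q n > 0" by (rule q_pos[OF n(1)])
      have u: "u n > 0" unfolding u_def using q n by simp
      have "0 < \<rho> n" using \<kappa>' u by (simp add: \<rho>_def)
      with elim(2) \<eta> have \<rho>: "0 < \<rho> n" "\<rho> n \<le> 1 / 2" "\<rho> n \<le> \<eta> / 8" by linarith+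
      define J where "J = {nat \<lceil>(1 - \<delta>) * real n\<rceil>..n}"
      have J_ge: "(1 - \<delta>) * real n \<le> real j" if "j \<in> J" for j
        using that unfolding J_def by simp
      have below: "nat \<lceil>(1 - \<delta>) * real n\<rceil> \<le> n"
      proof -
        have "(1 - \<delta>) * real n \<le> 1 * real n" using \<delta> by (intro mult_right_mono) auto
        then show ?thesis by (simp add: nat_le_iff ceiling_le_iff)
      qed
      have "0 < (1 - \<delta>) * real n" using \<delta> n by simp
      then have start: "1 \<le> nat \<lceil>(1 - \<delta>) * real n\<rceil>" "real (nat \<lceil>(1 - \<delta>) * real n\<rceil>) \<le> (1 - \<delta>) * real n + 1"
        by linarith+
      have J: "J \<subseteq> {1..n}" "J \<noteq> {}" using start(1) below unfolding J_def by auto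
      have cardJ: "\<delta> * real n \<le> real (card J)"
        using start(2) below unfolding J_def by (simp add: algebra_simps of_nat_diff)
      have rate: "w j / q n \<le> \<rho> n" if j: "j \<in> J" for j
      proof -
        have jn: "(1 - \<delta>) * real n \<le> real j" by (rule J_ge[OF j])
        have "1 / 2 * real n \<le> (1 - \<delta>) * real n" using \<delta> by (intro mult_right_mono) auto
        then have "i0 \<le> j" using jn n(4) by linarith
        have "(1 - \<delta>)\<^sup>2 * real n powr \<beta> \<le> ((1 - \<delta>) * real n) powr \<beta>"
        proof -
          have "(1 - \<delta>)\<^sup>2 = (1 - \<delta>) powr 2" using \<delta> by (simp add: powr_numeral)
          also have "\<dots> \<le> (1 - \<delta>) powr \<beta>" using \<delta> \<beta> by (intro powr_mono') auto
          finally show ?thesis using \<delta> n by (simp add: powr_mult mult_right_mono)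
        qed
        also have "\<dots> \<le> real j powr \<beta>" using jn \<delta> \<beta> n by (intro powr_mono2) auto
        finally have "w j * ((1 - \<delta>)\<^sup>2 * real n powr \<beta>) \<le> w j * real j powr \<beta>"
          using w_pos[of j] J(1) j by (intro mult_left_mono) auto
        also have "\<dots> \<le> \<kappa> * (1 + \<delta>)" using i0[OF \<open>i0 \<le> j\<close>] by simp
        finally have "w j * real n powr \<beta> \<le> \<kappa>'"
          using \<delta> by (simp add: \<kappa>'_def le_divide_eq mult_ac)
        then show ?thesis unfolding \<rho>_def u_def using q n by (simp add: field_simps)
      qed
      show ?case
      proof (intro allI impI)
        fix m assume m: "real m \<le> (1 - \<eta>) * t n"
        have "2 * real m * \<rho> n \<le> 2 * ((1 - \<eta>) * t n) * \<rho> n"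
          using m \<rho> by (intro mult_right_mono) auto
        also have "\<dots> = (1 - \<eta>) * (1 + \<delta>) / (1 - \<delta>)\<^sup>2 * ln (real n)"
          using \<kappa> u \<delta> by (simp add: t_def \<rho>_def \<kappa>'_def)
        also have "\<dots> \<le> (1 - \<eta> / 2) * ln (real n)"
          using \<delta>(1) n by (intro mult_right_mono) auto
        finally have "2 * real m * \<rho> n \<le> (1 - \<eta> / 2) * ln (real n)" .
        then have "2 * real m * \<rho> n * (1 + 2 * \<rho> n) \<le> (1 - \<eta> / 2) * ln (real n) * (1 + \<eta> / 4)"
          by (rule mult_mono) (use \<rho> \<eta> n in auto)
        also have "\<dots> = ((1 - \<eta> / 2) * (1 + \<eta> / 4)) * ln (real n)" by simp
        also have "\<dots> \<le> (1 - \<eta> / 4) * ln (real n)"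
        proof (rule mult_right_mono)
          have "(1 - \<eta> / 2) * (1 + \<eta> / 4) = 1 - \<eta> / 4 - \<eta>\<^sup>2 / 8" by (simp add: power2_eq_square algebra_simps)
          then show "(1 - \<eta> / 2) * (1 + \<eta> / 4) \<le> 1 - \<eta> / 4" by simp
        qed (use n in simp)
        finally have "exp (- ((1 - \<eta> / 4) * ln (real n))) \<le> exp (- (2 * real m * \<rho> n * (1 + 2 * \<rho> n)))" by simp
        also have "\<dots> = exp (- \<rho> n * (1 + 2 * \<rho> n)) ^ (2 * m)"
          by (simp add: exp_of_nat_mult[symmetric] mult_ac)
        also have "\<dots> \<le> (1 - \<rho> n) ^ (2 * m)"
          using \<rho> by (intro power_mono exp_le_one_minus) auto
        finally have "\<delta> * real n * exp (- ((1 - \<eta> / 4) * ln (real n))) \<le> real (card J) * (1 - \<rho> n) ^ (2 * m)"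
          using cardJ \<delta> n by (intro mult_mono) auto
        moreover have "real n * exp (- ((1 - \<eta> / 4) * ln (real n))) = real n powr (\<eta> / 4)"
        proof -
          have "real n = exp (ln (real n))" using n by simp
          then have "real n * exp (- ((1 - \<eta> / 4) * ln (real n))) = exp (ln (real n) - (1 - \<eta> / 4) * ln (real n))"
            by (metis exp_add uminus_add_conv_diff add.commute)
          also have "\<dots> = real n powr (\<eta> / 4)" using n by (simp add: powr_def algebra_simps)
          finally show ?thesis .
        qed
        ultimately have "8 / (1 - \<epsilon>) < real (card J) * (1 - \<rho> n) ^ (2 * m)"
          using elim(1) by (simp add: mult.assoc)
        moreover have "0 < 8 / (1 - \<epsilon>)" using \<epsilon> by simp
        moreover have "8 / Z < 1 - \<epsilon>" if "8 / (1 - \<epsilon>) < Z" "0 < 8 / (1 - \<epsilon>)" for Z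
        proof -
          have "8 < Z * (1 - \<epsilon>)" using that(1) \<epsilon> by (simp add: pos_divide_less_eq)
          moreover have "0 < Z" using that by linarith
          ultimately show ?thesis by (simp add: pos_divide_less_eq mult.commute)
        qed
        ultimately have "8 / (real (card J) * (1 - \<rho> n) ^ (2 * m)) < 1 - \<epsilon>" by blast
        moreover have "1 - 8 / (real (card J) * (1 - \<rho> n) ^ (2 * m)) \<le> d n m"
          using \<rho> by (intro d_ge_many_coordinates J rate) auto
        ultimately show "\<epsilon> < d n m" by linarith
      qed
    qed
  qed
  show "TV_mixing_diverges (family_group zmod_group) (family_prob zmod_group zmod_prob p)"
    by (rule cutoff_if_window(1)[where t = t], fact t_lim, fact upper, fact lower)
  show "TV_cutoff (family_group zmod_group) (family_prob zmod_group zmod_prob p)"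
    by (rule cutoff_if_window(2)[where t = t], fact t_lim, fact upper, fact lower)
qed

end

section \<open>Random weights\<close>

lemma (in prob_space) strong_law_iid_positive:
  fixes f :: "real \<Rightarrow> real"
  assumes iid: "iid_positive M X" and f [measurable]: "f \<in> borel_measurable borel"
    and int: "integrable M (\<lambda>\<omega>. f (X 1 \<omega>))"
  shows "AE \<omega> in M. (\<lambda>n. (\<Sum>i=1..n. f (X i \<omega>)) / real n) \<longlonglongrightarrow> expectation (\<lambda>\<omega>. f (X 1 \<omega>))"
proof -
  have indep: "indep_vars (\<lambda>_. borel) X {1..}"
    using iid unfolding iid_positive_def by blast
  have ident: "distr M borel (X n) = distr M borel (X 1)" if "n \<ge> 1" for n
    using iid that unfolding iid_positive_def by blast
  have "range Suc = {1..}"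
    by (auto simp: image_iff Suc_le_eq gr0_conv_Suc)
  with indep have "indep_vars (\<lambda>_. borel) (\<lambda>i. X (Suc i)) UNIV"
    using indep_vars_reindex[of Suc UNIV borel X] by simp
  from indep_vars_compose[OF this, of "\<lambda>_. f" "\<lambda>_. borel"]
  have indep_f: "indep_vars (\<lambda>_. borel) (\<lambda>i \<omega>. f (X (Suc i) \<omega>)) UNIV"
    by (simp add: comp_def)
  have rv [measurable]: "random_variable borel (X (Suc i))" for i
    using indep unfolding indep_vars_def2 by auto
  have ident_f: "distr M borel (\<lambda>\<omega>. f (X (Suc i) \<omega>)) = distr M borel (\<lambda>\<omega>. f (X (Suc 0) \<omega>))" for i
  proof -
    have "distr M borel (\<lambda>\<omega>. f (X (Suc i) \<omega>)) = distr (distr M borel (X (Suc i))) borel f" for i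
      by (simp add: distr_distr comp_def)
    moreover have "distr M borel (X (Suc i)) = distr M borel (X (Suc 0))"
      using ident[of "Suc i"] by (simp only: One_nat_def le_numeral_extra Suc_le_mono le0)
    ultimately show ?thesis by metis
  qed
  have "AE \<omega> in M. (\<lambda>n. (\<Sum>i<n. f (X (Suc i) \<omega>)) / real n) \<longlonglongrightarrow> expectation (\<lambda>\<omega>. f (X (Suc 0) \<omega>))"
    using int by (intro strong_law_of_large_numbers indep_f ident_f) simp
  then show ?thesis by (simp add: sum.atLeast1_atMost_eq)
qed

text \<open>
  By hypothesis the weights are asymptotic to \<open>(\<mu> * n) powr \<gamma>\<close>, and dividing by \<open>n\<^sup>2\<close> leaves the
  exponent \<open>\<gamma> - 2\<close>, whose sign decides.
\<close>
lemma cutoff_powers_of_partial_sums: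
  fixes x :: "nat \<Rightarrow> real"
  defines "p \<equiv> \<lambda>\<gamma> n. (\<Sum>i=1..n. x i) powr \<gamma>"
  assumes x: "\<And>i. i \<ge> 1 \<Longrightarrow> 0 < x i" and \<mu>: "\<mu> > 0"
    and lim: "(\<lambda>n. (\<Sum>i=1..n. x i) / real n) \<longlonglongrightarrow> \<mu>"
  shows "0 < \<gamma> \<Longrightarrow> \<gamma> \<le> 2 \<Longrightarrow>
      TV_mixing_diverges (family_group zmod_group) (family_prob zmod_group zmod_prob (p \<gamma>)) \<and>
      TV_cutoff (family_group zmod_group) (family_prob zmod_group zmod_prob (p \<gamma>))"
    and "2 < \<gamma> \<Longrightarrow>
      TV_mixing_diverges (family_group zmod_group) (family_prob zmod_group zmod_prob (p \<gamma>)) \<and>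
      \<not> TV_cutoff (family_group zmod_group) (family_prob zmod_group zmod_prob (p \<gamma>))"
proof -
  define S where "S n = (\<Sum>i=1..n. x i)" for n
  have S_pos: "0 < S n" if "n \<ge> 1" for n
    unfolding S_def using that x by (intro sum_pos) auto
  have p: "p \<gamma> = (\<lambda>n. S n powr \<gamma>)" for \<gamma> by (simp add: p_def S_def)
  have weights: "positive_weights (p \<gamma>)" for \<gamma>
    unfolding p by standard (use S_pos in \<open>simp add: less_imp_neq[THEN not_sym]\<close>)
  have lim: "(\<lambda>n. S n / real n) \<longlonglongrightarrow> \<mu>" using lim by (simp add: S_def)
  show "TV_mixing_diverges (family_group zmod_group) (family_prob zmod_group zmod_prob (p \<gamma>)) \<and>
      TV_cutoff (family_group zmod_group) (family_prob zmod_group zmod_prob (p \<gamma>))"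
    if \<gamma>: "0 < \<gamma>" "\<gamma> \<le> 2" for \<gamma>
  proof -
    have "(\<lambda>n. (S n / real n) powr \<gamma>) \<longlonglongrightarrow> \<mu> powr \<gamma>"
      using \<mu> by (intro tendsto_powr lim tendsto_const) auto
    moreover have "\<forall>\<^sub>F n in sequentially. (S n / real n) powr \<gamma> = p \<gamma> n / real n powr \<gamma>"
      using eventually_ge_at_top[of 1]
      by eventually_elim (use S_pos in \<open>simp add: p powr_divide less_imp_le\<close>)
    ultimately have asymp: "(\<lambda>n. p \<gamma> n / real n powr \<gamma>) \<longlonglongrightarrow> \<mu> powr \<gamma>"
      by (rule Lim_transform_eventually)
    have "\<mu> powr \<gamma> > 0" using \<mu> by simp
    then show ?thesis
      using positive_weights.cutoff_if_power_law[OF weights \<gamma> _ asymp] by blast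
  qed
  show "TV_mixing_diverges (family_group zmod_group) (family_prob zmod_group zmod_prob (p \<gamma>)) \<and>
      \<not> TV_cutoff (family_group zmod_group) (family_prob zmod_group zmod_prob (p \<gamma>))"
    if \<gamma>: "2 < \<gamma>" for \<gamma>
  proof -
    interpret positive_weights "p \<gamma>" by (rule weights)
    define \<delta> where "\<delta> = \<gamma> - 2"
    have \<delta>: "\<delta> > 0" and \<gamma>_eq: "\<gamma> = 2 + \<delta>" using \<gamma> by (auto simp: \<delta>_def)
    have "filterlim (\<lambda>n. (\<mu> / 2 * real n) powr (2 + \<delta>) * (sin (pi / (real n + 2)))\<^sup>2 / ln (real n + 1)) at_top sequentially"
      using \<mu> \<delta> by real_asymp
    then have "filterlim (\<lambda>n. w n / ln (real n + 1)) at_top sequentially"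
    proof (rule filterlim_at_top_mono)
      have "\<forall>\<^sub>F n in sequentially. \<mu> / 2 < S n / real n"
        using lim \<mu> by (intro order_tendstoD(1)) auto
      then show "\<forall>\<^sub>F n in sequentially. (\<mu> / 2 * real n) powr (2 + \<delta>) * (sin (pi / (real n + 2)))\<^sup>2 / ln (real n + 1)
          \<le> w n / ln (real n + 1)"
        using eventually_ge_at_top[of 1]
      proof eventually_elim
        case (elim n)
        have "\<mu> / 2 * real n \<le> S n" using elim by (simp add: less_divide_eq)
        then have "(\<mu> / 2 * real n) powr (2 + \<delta>) \<le> p \<gamma> n"
          unfolding p \<gamma>_eq using \<mu> \<delta> by (intro powr_mono2) auto
        then show ?case
          unfolding w_def gap_def using elim(2)
          by (intro divide_right_mono mult_mono) (auto simp: add.commute p)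
      qed
    qed
    from no_cutoff_if_rates_outgrow_log[OF this] show ?thesis by blast
  qed
qed

text \<open>
  The weights are eventually at least \<open>exp (\<mu> * n / 2)\<close>, which outgrows the factor \<open>n\<^sup>2\<close> lost in the gap.
\<close>
lemma no_cutoff_products:
  fixes x :: "nat \<Rightarrow> real"
  defines "p \<equiv> \<lambda>n. \<Prod>i=1..n. x i"
  assumes x: "\<And>i. i \<ge> 1 \<Longrightarrow> 0 < x i" and \<mu>: "\<mu> > 0"
    and lim: "(\<lambda>n. (\<Sum>i=1..n. ln (x i)) / real n) \<longlonglongrightarrow> \<mu>"
  shows "TV_mixing_diverges (family_group zmod_group) (family_prob zmod_group zmod_prob p) \<and>
      \<not> TV_cutoff (family_group zmod_group) (family_prob zmod_group zmod_prob p)"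
proof -
  interpret positive_weights p
    by standard (use x in \<open>auto simp: p_def intro!: prod_pos\<close>)
  have "filterlim (\<lambda>n. exp (\<mu> / 2 * real n) * (sin (pi / (real n + 2)))\<^sup>2 / ln (real n + 1)) at_top sequentially"
    using \<mu> by real_asymp
  then have "filterlim (\<lambda>n. w n / ln (real n + 1)) at_top sequentially"
  proof (rule filterlim_at_top_mono)
    have "\<forall>\<^sub>F n in sequentially. \<mu> / 2 < (\<Sum>i=1..n. ln (x i)) / real n"
      using lim \<mu> by (intro order_tendstoD(1)) auto
    then show "\<forall>\<^sub>F n in sequentially. exp (\<mu> / 2 * real n) * (sin (pi / (real n + 2)))\<^sup>2 / ln (real n + 1)
        \<le> w n / ln (real n + 1)"
      using eventually_ge_at_top[of 1]
    proof eventually_elim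
      case (elim n)
      have "\<mu> / 2 * real n \<le> (\<Sum>i=1..n. ln (x i))" using elim by (simp add: less_divide_eq)
      also have "exp \<dots> = p n" using x by (simp add: exp_sum p_def)
      finally have "exp (\<mu> / 2 * real n) \<le> p n" by simp
      then show ?case
        unfolding w_def gap_def using elim(2) p_pos[of n]
        by (intro divide_right_mono mult_mono) (auto simp: add.commute)
    qed
  qed
  from no_cutoff_if_rates_outgrow_log[OF this] show ?thesis by blast
qed

theorem proposition1p3:
  fixes M :: "'w measure" and X :: "nat \<Rightarrow> 'w \<Rightarrow> real"
  assumes "prob_space M" and "iid_positive M X"
  defines "\<G> \<equiv> family_group zmod_group"
    and "\<Q> \<equiv> family_prob zmod_group zmod_prob"
    and "p1 \<equiv> (\<lambda>\<gamma> \<omega> n. (\<Sum>i=1..n. X i \<omega>) powr \<gamma>)"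
    and "p2 \<equiv> (\<lambda>\<omega> n. \<Prod>i=1..n. X i \<omega>)"
  shows
    "(\<forall>\<gamma>>0. integrable M (X 1) \<longrightarrow>
        (\<gamma> \<le> 2 \<longrightarrow>
          (AE \<omega> in M. TV_mixing_diverges \<G> (\<Q> (p1 \<gamma> \<omega>)) \<and> TV_cutoff \<G> (\<Q> (p1 \<gamma> \<omega>)))) \<and>
        (\<gamma> > 2 \<longrightarrow>
          (AE \<omega> in M. TV_mixing_diverges \<G> (\<Q> (p1 \<gamma> \<omega>)) \<and> \<not> TV_cutoff \<G> (\<Q> (p1 \<gamma> \<omega>))))) \<and>
     (integrable M (\<lambda>\<omega>. ln (X 1 \<omega>)) \<and> (\<integral>\<omega>. ln (X 1 \<omega>) \<partial>M) > 0 \<longrightarrow>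
        (AE \<omega> in M. TV_mixing_diverges \<G> (\<Q> (p2 \<omega>)) \<and> \<not> TV_cutoff \<G> (\<Q> (p2 \<omega>))))"
proof -
  interpret prob_space M by fact
  have pos_i: "AE \<omega> in M. 0 < X i \<omega>" if "i \<ge> 1" for i
    using \<open>iid_positive M X\<close> that unfolding iid_positive_def by blast
  then have pos: "AE \<omega> in M. \<forall>i\<ge>1. 0 < X i \<omega>"
    by (simp add: AE_all_countable)
  have pos1: "AE \<omega> in M. 0 < X 1 \<omega>" by (rule pos_i) simp
  have sums: "AE \<omega> in M. (\<lambda>n. (\<Sum>i=1..n. X i \<omega>) / real n) \<longlonglongrightarrow> expectation (X 1)"
    if "integrable M (X 1)"
    using strong_law_iid_positive[OF \<open>iid_positive M X\<close>, of "\<lambda>x. x"] that by simp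
  have mean: "expectation (X 1) > 0" if "integrable M (X 1)"
    using that pos1 by (rule expectation_greater)
  show ?thesis
  proof (intro conjI allI impI)
    fix \<gamma> :: real assume \<gamma>: "\<gamma> > 0" and int: "integrable M (X 1)"
    show "AE \<omega> in M. TV_mixing_diverges \<G> (\<Q> (p1 \<gamma> \<omega>)) \<and> TV_cutoff \<G> (\<Q> (p1 \<gamma> \<omega>))" if "\<gamma> \<le> 2"
      using pos sums[OF int]
    proof eventually_elim
      case (elim \<omega>)
      show ?case
        unfolding \<G>_def \<Q>_def p1_def
        using elim(1) by (intro cutoff_powers_of_partial_sums(1)[OF _ mean[OF int] elim(2) \<gamma> that]) auto
    qed
    show "AE \<omega> in M. TV_mixing_diverges \<G> (\<Q> (p1 \<gamma> \<omega>)) \<and> \<not> TV_cutoff \<G> (\<Q> (p1 \<gamma> \<omega>))" if "\<gamma> > 2"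
      using pos sums[OF int]
    proof eventually_elim
      case (elim \<omega>)
      show ?case
        unfolding \<G>_def \<Q>_def p1_def
        using elim(1) by (intro cutoff_powers_of_partial_sums(2)[OF _ mean[OF int] elim(2) that]) auto
    qed
  next
    assume asm: "integrable M (\<lambda>\<omega>. ln (X 1 \<omega>)) \<and> (\<integral>\<omega>. ln (X 1 \<omega>) \<partial>M) > 0"
    then have "AE \<omega> in M. (\<lambda>n. (\<Sum>i=1..n. ln (X i \<omega>)) / real n) \<longlonglongrightarrow> expectation (\<lambda>\<omega>. ln (X 1 \<omega>))"
      by (intro strong_law_iid_positive[OF \<open>iid_positive M X\<close>]) auto
    with pos show "AE \<omega> in M. TV_mixing_diverges \<G> (\<Q> (p2 \<omega>)) \<and> \<not> TV_cutoff \<G> (\<Q> (p2 \<omega>))"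
    proof eventually_elim
      case (elim \<omega>)
      show ?case
        unfolding \<G>_def \<Q>_def p2_def
        using elim(1) asm by (intro no_cutoff_products[OF _ _ elim(2)]) auto
    qed
  qed
qed

end
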